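(* Let $F=\alpha^{1+m}\beta^{-m}$, $m\neq0$, be an $m$-Kropina metric of Berwald type on a smooth manifold $M$ with $\dim M>2$, built from a (pseudo-)Riemannian metric $a$ and a 1-form $b$, and let $f=f_i\,dx^i$ be the 1-form appearing in the Berwald condition $\mathring\nabla_j b_i = m (f_k b^k)a_{ij} + b_i f_j - m f_i b_j$. Suppose that the first de Rham cohomology group of $M$ is trivial. Then the following are equivalent: (i) $F$ is (globally) metrizable; (ii) $F$ is locally metrizable; (iii) the affine Ricci tensor of $F$ is symmetric; (iv) $f$ is a closed 1-form. In that case, writing $f=d\psi$ with $\psi\in C^\infty(M)$, a global metrization of $F$ is given by $\tilde a=e^{-2m\psi}a$, and moreover $\tilde b=e^{-(1+m)\psi}b$ is parallel with respect to (the Levi-Civita connection of) $\tilde a$.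
   Context: Finsler metrics. Let $M$ be a smooth manifold of dimension $n$, with local coordinates $x^i$ and induced coordinates $(x,y)$ on $TM$ (a tangent vector is $y^i\partial_i$); write $\partial_i=\partial/\partial x^i$, $\bar\partial_i=\partial/\partial y^i$. A conic subbundle of $TM$ is an open subset $\mathcal A\subset TM$ such that $(x,\lambda y)\in\mathcal A$ for all $(x,y)\in\mathcal A$, $\lambda>0$, and whose projection to $M$ is all of $M$. A Finsler metric on $\mathcal A$ is a smooth map $F:\mathcal A\to[0,\infty)$ with $F(x,\lambda y)=\lambda F(x,y)$ for $\lambda>0$ and with nondegenerate fundamental tensor $g_{ij}=\bar\partial_i\bar\partial_j(\tfrac12F^2)$. Berwald metrics. The canonical nonlinear connection has coefficients $N^j_i=\tfrac14\bar\partial_i\big[g^{jk}(y^l\partial_l\bar\partial_kF^2-\partial_kF^2)\big]$. $F$ is of Berwald type if $N^k_i=\Gamma^k_{ij}(x)y^j$ for functions $\Gamma^k_{ij}$ on the base; these are then the Christoffel symbols of a torsion-free affine connection on $M$, called the affine connection of $F$. The affine Ricci tensor is $\bar R_{lk}=\bar R^i{}_{lik}$, with $\bar R^k{}_{\ell ij}=\partial_i\Gamma^k_{j\ell}-\partial_j\Gamma^k_{i\ell}+\Gamma^k_{im}\Gamma^m_{j\ell}-\Gamma^k_{jm}\Gamma^m_{i\ell}$. Metrizability. A Berwald metric $F$ on $M$ is (globally) metrizable if its affine connection is the Levi-Civita connection of some pseudo-Riemannian metric on $M$ (a global metrization); it is locally metrizable if each point of $M$ has a neighborhood admitting a pseudo-Riemannian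 metric whose Levi-Civita connection is the restriction of the affine connection of $F$. $m$-Kropina metrics. An $m$-Kropina metric is a Finsler metric of the form $F=\alpha^{1+m}\beta^{-m}$ with $\alpha=\sqrt{|a_{ij}y^iy^j|}$, $\beta=b_iy^i$, where $a$ is a (pseudo-)Riemannian metric of arbitrary signature and $b$ a 1-form on $M$, and $m\in\mathbb R$; $b$ is then nowhere vanishing. The trivial case $m=0$ is excluded. Indices are raised and lowered with $a_{ij}$, and $\mathring\nabla$, $\mathring\Gamma$ denote the Levi-Civita connection of $a$ and its Christoffel symbols. Known fact defining $f$: for $n>2$, $F$ is of Berwald type iff there is a smooth vector field $f^i$ on $M$ with $\mathring\nabla_j b_i = m (f_k b^k)a_{ij} + b_i f_j - m f_i b_j$. In that case $f$ is unique and the affine connection of $F$ is $\Gamma^\ell_{ij}=\mathring\Gamma^\ell_{ij}+m a^{\ell k}(a_{ij}f_k-a_{jk}f_i-a_{ki}f_j)$. *)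

theory Defs
  imports "HOL-Analysis.Analysis"
begin

section \<open>Smooth maps and partial derivatives\<close>

text \<open>Only meaningful for open sets \<open>S\<close>.\<close>

primrec Ck_on :: "nat \<Rightarrow> 'a::real_normed_vector set \<Rightarrow> ('a \<Rightarrow> 'b::real_normed_vector) \<Rightarrow> bool" where
  "Ck_on 0 S f \<longleftrightarrow> continuous_on S f"
| "Ck_on (Suc k) S f \<longleftrightarrow>
     (\<forall>x\<in>S. f differentiable (at x)) \<and> (\<forall>v. Ck_on k S (\<lambda>x. frechet_derivative f (at x) v))"

definition smooth_on :: "'a::real_normed_vector set \<Rightarrow> ('a \<Rightarrow> 'b::real_normed_vector) \<Rightarrow> bool" where
  "smooth_on S f \<longleftrightarrow> (\<forall>k. Ck_on k S f)"

definition pd :: "'n \<Rightarrow> (real^'n \<Rightarrow> real) \<Rightarrow> real^'n \<Rightarrow> real" where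
  "pd i f x = frechet_derivative f (at x) (axis i 1)"

section \<open>Smooth manifolds\<close>

text \<open>A chart is a pair of its domain and its coordinate map; the values of the coordinate map
  outside the domain are irrelevant. A manifold is a topological space with a smooth atlas,
  which need not be maximal: a geometric object given in the charts of an atlas extends uniquely to
  all compatible charts.\<close>

type_synonym ('p, 'n) chart = "'p set \<times> ('p \<Rightarrow> real^'n)"

definition is_chart :: "'p topology \<Rightarrow> ('p, 'n::finite) chart \<Rightarrow> bool" where
  "is_chart X c \<longleftrightarrow> openin X (fst c) \<and> open (snd c ` fst c) \<and>
     homeomorphic_map (subtopology X (fst c)) (top_of_set (snd c ` fst c)) (snd c)"

definition chart_inv :: "('p, 'n) chart \<Rightarrow> real^'n \<Rightarrow> 'p" where
  "chart_inv c = inv_into (fst c) (snd c)"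

text \<open>The part of the coordinate domain of \<open>c\<close> that represents points of \<open>W\<close>.\<close>

definition coords :: "('p, 'n) chart \<Rightarrow> 'p set \<Rightarrow> (real^'n) set" where
  "coords c W = snd c ` (fst c \<inter> W)"

definition transition :: "('p, 'n) chart \<Rightarrow> ('p, 'n) chart \<Rightarrow> real^'n \<Rightarrow> real^'n" where
  "transition c d x = snd d (chart_inv c x)"

definition trans_jac :: "('p, 'n::finite) chart \<Rightarrow> ('p, 'n) chart \<Rightarrow> real^'n \<Rightarrow> real^'n^'n" where
  "trans_jac c d x = jacobian (transition c d) (at x)"

definition smooth_manifold :: "'p topology \<Rightarrow> ('p, 'n::finite) chart set \<Rightarrow> bool" where
  "smooth_manifold X \<A> \<longleftrightarrow>
     Hausdorff_space X \<and> second_countable X \<and>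
     (\<forall>c\<in>\<A>. is_chart X c) \<and> (\<Union>c\<in>\<A>. fst c) = topspace X \<and>
     (\<forall>c\<in>\<A>. \<forall>d\<in>\<A>. smooth_on (coords c (fst d)) (transition c d))"

section \<open>Functions, 1-forms and metrics on an open subset \<open>W\<close>\<close>

text \<open>Tensor fields are given by their components in the charts of the atlas, subject to the
  transformation law; the values of \<open>w c\<close> outside \<open>coords c W\<close> are irrelevant.\<close>

definition smooth_fun :: "('p, 'n::finite) chart set \<Rightarrow> 'p set \<Rightarrow> ('p \<Rightarrow> real) \<Rightarrow> bool" where
  "smooth_fun \<A> W \<psi> \<longleftrightarrow> (\<forall>c\<in>\<A>. smooth_on (coords c W) (\<psi> \<circ> chart_inv c))"

type_synonym ('p, 'n) covector_field = "('p, 'n) chart \<Rightarrow> real^'n \<Rightarrow> real^'n"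
type_synonym ('p, 'n) tensor2_field = "('p, 'n) chart \<Rightarrow> real^'n \<Rightarrow> real^'n^'n"

definition one_form :: "('p, 'n::finite) chart set \<Rightarrow> 'p set \<Rightarrow> ('p, 'n) covector_field \<Rightarrow> bool" where
  "one_form \<A> W w \<longleftrightarrow>
     (\<forall>c\<in>\<A>. smooth_on (coords c W) (w c)) \<and>
     (\<forall>c\<in>\<A>. \<forall>d\<in>\<A>. \<forall>x\<in>coords c (fst d \<inter> W).
        w c x = w d (transition c d x) v* trans_jac c d x)"

definition closed_form :: "('p, 'n::finite) chart set \<Rightarrow> 'p set \<Rightarrow> ('p, 'n) covector_field \<Rightarrow> bool" where
  "closed_form \<A> W w \<longleftrightarrow> (\<forall>c\<in>\<A>. \<forall>x\<in>coords c W. \<forall>i j.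
     pd i (\<lambda>x. w c x $ j) x = pd j (\<lambda>x. w c x $ i) x)"

definition is_differential ::
    "('p, 'n::finite) chart set \<Rightarrow> 'p set \<Rightarrow> ('p \<Rightarrow> real) \<Rightarrow> ('p, 'n) covector_field \<Rightarrow> bool" where
  "is_differential \<A> W \<psi> w \<longleftrightarrow> (\<forall>c\<in>\<A>. \<forall>x\<in>coords c W. \<forall>i.
     w c x $ i = pd i (\<psi> \<circ> chart_inv c) x)"

definition exact_form :: "('p, 'n::finite) chart set \<Rightarrow> 'p set \<Rightarrow> ('p, 'n) covector_field \<Rightarrow> bool" where
  "exact_form \<A> W w \<longleftrightarrow> (\<exists>\<psi>. smooth_fun \<A> W \<psi> \<and> is_differential \<A> W \<psi> w)"

definition trivial_H1_dR :: "('p, 'n::finite) chart set \<Rightarrow> 'p set \<Rightarrow> bool" where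
  "trivial_H1_dR \<A> W \<longleftrightarrow>
     (\<forall>w. one_form \<A> W w \<and> closed_form \<A> W w \<longrightarrow> exact_form \<A> W w)"

definition pseudo_riemannian ::
    "('p, 'n::finite) chart set \<Rightarrow> 'p set \<Rightarrow> ('p, 'n) tensor2_field \<Rightarrow> bool" where
  "pseudo_riemannian \<A> W a \<longleftrightarrow>
     (\<forall>c\<in>\<A>. smooth_on (coords c W) (a c)) \<and>
     (\<forall>c\<in>\<A>. \<forall>d\<in>\<A>. \<forall>x\<in>coords c (fst d \<inter> W).
        a c x = transpose (trans_jac c d x) ** a d (transition c d x) ** trans_jac c d x) \<and>
     (\<forall>c\<in>\<A>. \<forall>x\<in>coords c W. transpose (a c x) = a c x \<and> invertible (a c x))"

section \<open>Connections in local coordinates\<close>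

text \<open>\<open>\<Gamma> x k i j\<close> stands for \<open>\<Gamma>\<^sup>k\<^sub>i\<^sub>j(x)\<close>.\<close>

type_synonym 'n christoffel = "real^'n \<Rightarrow> 'n \<Rightarrow> 'n \<Rightarrow> 'n \<Rightarrow> real"

definition levi_civita :: "(real^'n \<Rightarrow> real^'n^'n) \<Rightarrow> ('n::finite) christoffel" where
  "levi_civita a x k i j = (1/2) * (\<Sum>l\<in>UNIV. matrix_inv (a x) $ k $ l *
     (pd i (\<lambda>x. a x $ l $ j) x + pd j (\<lambda>x. a x $ l $ i) x - pd l (\<lambda>x. a x $ i $ j) x))"

text \<open>\<open>cov_deriv \<Gamma> w x j i\<close> stands for \<open>\<nabla>\<^sub>j w\<^sub>i\<close> at \<open>x\<close>.\<close>

definition cov_deriv :: "('n::finite) christoffel \<Rightarrow> (real^'n \<Rightarrow> real^'n) \<Rightarrow> real^'n \<Rightarrow> 'n \<Rightarrow> 'n \<Rightarrow> real" where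
  "cov_deriv \<Gamma> w x j i = pd j (\<lambda>x. w x $ i) x - (\<Sum>k\<in>UNIV. \<Gamma> x k j i * w x $ k)"

text \<open>\<open>curvature \<Gamma> x k l i j\<close> stands for \<open>R\<^sup>k\<^sub>l\<^sub>i\<^sub>j\<close>; the Ricci tensor is \<open>R\<^sub>l\<^sub>k = R\<^sup>i\<^sub>l\<^sub>i\<^sub>k\<close>.\<close>

definition curvature :: "('n::finite) christoffel \<Rightarrow> real^'n \<Rightarrow> 'n \<Rightarrow> 'n \<Rightarrow> 'n \<Rightarrow> 'n \<Rightarrow> real" where
  "curvature \<Gamma> x k l i j =
     pd i (\<lambda>x. \<Gamma> x k j l) x - pd j (\<lambda>x. \<Gamma> x k i l) x
     + (\<Sum>m\<in>UNIV. \<Gamma> x k i m * \<Gamma> x m j l) - (\<Sum>m\<in>UNIV. \<Gamma> x k j m * \<Gamma> x m i l)"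

definition ricci :: "('n::finite) christoffel \<Rightarrow> real^'n \<Rightarrow> 'n \<Rightarrow> 'n \<Rightarrow> real" where
  "ricci \<Gamma> x l k = (\<Sum>i\<in>UNIV. curvature \<Gamma> x i l i k)"

definition parallel_form ::
    "('p, 'n::finite) chart set \<Rightarrow> 'p set \<Rightarrow> ('p, 'n) tensor2_field \<Rightarrow> ('p, 'n) covector_field \<Rightarrow> bool" where
  "parallel_form \<A> W a w \<longleftrightarrow>
     (\<forall>c\<in>\<A>. \<forall>x\<in>coords c W. \<forall>i j. cov_deriv (levi_civita (a c)) (w c) x j i = 0)"

section \<open>Finsler metrics\<close>

text \<open>Subsets of the tangent bundle and functions on them are given in the induced coordinates
  \<open>(x, y)\<close>, and tangent vectors transform with the Jacobian of the transition map.\<close>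

type_synonym ('p, 'n) tangent_subset = "('p, 'n) chart \<Rightarrow> ((real^'n) \<times> (real^'n)) set"
type_synonym ('p, 'n) tangent_fun = "('p, 'n) chart \<Rightarrow> real^'n \<Rightarrow> real^'n \<Rightarrow> real"

definition conic_subbundle ::
    "'p topology \<Rightarrow> ('p, 'n::finite) chart set \<Rightarrow> ('p, 'n) tangent_subset \<Rightarrow> bool" where
  "conic_subbundle X \<A> C \<longleftrightarrow>
     (\<forall>c\<in>\<A>. open (C c) \<and> fst ` C c = coords c (topspace X) \<and>
        (\<forall>x y. \<forall>r>0. (x, y) \<in> C c \<longrightarrow> (x, r *\<^sub>R y) \<in> C c)) \<and>
     (\<forall>c\<in>\<A>. \<forall>d\<in>\<A>. \<forall>x\<in>coords c (fst d). \<forall>y.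
        (x, y) \<in> C c \<longleftrightarrow> (transition c d x, trans_jac c d x *v y) \<in> C d)"

definition fundamental_tensor :: "(real^'n \<Rightarrow> real^'n \<Rightarrow> real) \<Rightarrow> real^'n \<Rightarrow> real^'n \<Rightarrow> real^'n^('n::finite)" where
  "fundamental_tensor F x y = (\<chi> i j. pd i (\<lambda>y. pd j (\<lambda>y. (1/2) * (F x y)\<^sup>2) y) y)"

definition finsler_metric ::
    "'p topology \<Rightarrow> ('p, 'n::finite) chart set \<Rightarrow> ('p, 'n) tangent_subset \<Rightarrow> ('p, 'n) tangent_fun \<Rightarrow> bool" where
  "finsler_metric X \<A> C F \<longleftrightarrow> conic_subbundle X \<A> C \<and>
     (\<forall>c\<in>\<A>. \<forall>d\<in>\<A>. \<forall>x\<in>coords c (fst d). \<forall>y. (x, y) \<in> C c \<longrightarrow>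
        F c x y = F d (transition c d x) (trans_jac c d x *v y)) \<and>
     (\<forall>c\<in>\<A>. smooth_on (C c) (\<lambda>(x, y). F c x y) \<and>
        (\<forall>(x, y)\<in>C c. 0 \<le> F c x y \<and> (\<forall>r>0. F c x (r *\<^sub>R y) = r * F c x y) \<and>
           invertible (fundamental_tensor (F c) x y)))"

text \<open>\<open>nonlinear_conn F x y j i\<close> stands for \<open>N\<^sup>j\<^sub>i(x, y)\<close>.\<close>

definition nonlinear_conn ::
    "(real^'n \<Rightarrow> real^'n \<Rightarrow> real) \<Rightarrow> real^'n \<Rightarrow> real^'n \<Rightarrow> 'n \<Rightarrow> 'n::finite \<Rightarrow> real" where
  "nonlinear_conn F x y j i = (1/4) * pd i (\<lambda>y. \<Sum>k\<in>UNIV. matrix_inv (fundamental_tensor F x y) $ j $ k *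
     ((\<Sum>l\<in>UNIV. y $ l * pd l (\<lambda>x. pd k (\<lambda>y. (F x y)\<^sup>2) y) x) - pd k (\<lambda>x. (F x y)\<^sup>2) x)) y"

definition berwald_type ::
    "('p, 'n::finite) chart set \<Rightarrow> ('p, 'n) tangent_subset \<Rightarrow> ('p, 'n) tangent_fun \<Rightarrow> bool" where
  "berwald_type \<A> C F \<longleftrightarrow> (\<exists>\<Gamma>. \<forall>c\<in>\<A>. \<forall>(x, y)\<in>C c. \<forall>k i.
     nonlinear_conn (F c) x y k i = (\<Sum>j\<in>UNIV. \<Gamma> c x k i j * y $ j))"

text \<open>The fibres of a conic subbundle are open and nonempty, so for a metric of Berwald type the
  coefficients below exist uniquely at every point of a coordinate domain.\<close>

definition affine_connection ::
    "('p, 'n::finite) tangent_subset \<Rightarrow> ('p, 'n) tangent_fun \<Rightarrow> ('p, 'n) chart \<Rightarrow> 'n christoffel" where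
  "affine_connection C F c x = (THE G. \<forall>y. (x, y) \<in> C c \<longrightarrow>
     (\<forall>k i. nonlinear_conn (F c) x y k i = (\<Sum>j\<in>UNIV. G k i j * y $ j)))"

definition ricci_symmetric ::
    "'p topology \<Rightarrow> ('p, 'n::finite) chart set \<Rightarrow> ('p, 'n) tangent_subset \<Rightarrow> ('p, 'n) tangent_fun \<Rightarrow> bool" where
  "ricci_symmetric X \<A> C F \<longleftrightarrow> (\<forall>c\<in>\<A>. \<forall>x\<in>coords c (topspace X). \<forall>l k.
     ricci (affine_connection C F c) x l k = ricci (affine_connection C F c) x k l)"

definition metrization_on ::
    "('p, 'n::finite) chart set \<Rightarrow> ('p, 'n) tangent_subset \<Rightarrow> ('p, 'n) tangent_fun \<Rightarrow>
     'p set \<Rightarrow> ('p, 'n) tensor2_field \<Rightarrow> bool" where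
  "metrization_on \<A> C F W h \<longleftrightarrow> pseudo_riemannian \<A> W h \<and>
     (\<forall>c\<in>\<A>. \<forall>x\<in>coords c W. levi_civita (h c) x = affine_connection C F c x)"

definition metrizable ::
    "'p topology \<Rightarrow> ('p, 'n::finite) chart set \<Rightarrow> ('p, 'n) tangent_subset \<Rightarrow> ('p, 'n) tangent_fun \<Rightarrow> bool" where
  "metrizable X \<A> C F \<longleftrightarrow> (\<exists>h. metrization_on \<A> C F (topspace X) h)"

definition locally_metrizable ::
    "'p topology \<Rightarrow> ('p, 'n::finite) chart set \<Rightarrow> ('p, 'n) tangent_subset \<Rightarrow> ('p, 'n) tangent_fun \<Rightarrow> bool" where
  "locally_metrizable X \<A> C F \<longleftrightarrow>
     (\<forall>p\<in>topspace X. \<exists>W h. openin X W \<and> p \<in> W \<and> metrization_on \<A> C F W h)"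

section \<open>m-Kropina metrics\<close>

text \<open>Real powers: integer exponents are allowed for any nonzero base, other exponents for a
  positive base only.\<close>

definition rpow :: "real \<Rightarrow> real \<Rightarrow> real" where
  "rpow t r = (if r \<in> \<int> then t powi \<lfloor>r\<rfloor> else t powr r)"

definition rpow_defined :: "real \<Rightarrow> real \<Rightarrow> bool" where
  "rpow_defined t r \<longleftrightarrow> t > 0 \<or> (r \<in> \<int> \<and> t \<noteq> 0)"

text \<open>For \<open>m \<noteq> 0\<close> in dimension at least 2, requiring both powers to have nonzero base is no
  restriction: at a point with \<open>\<alpha> = 0\<close> or \<open>\<beta> = 0\<close>, the function \<open>F\<^sup>2\<close> either is undefined arbitrarily
  close by, or is not twice differentiable, or has a degenerate Hessian.\<close>

definition kropina_metric ::
    "'p topology \<Rightarrow> ('p, 'n::finite) chart set \<Rightarrow> ('p, 'n) tangent_subset \<Rightarrow> real \<Rightarrow>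
     ('p, 'n) tensor2_field \<Rightarrow> ('p, 'n) covector_field \<Rightarrow> ('p, 'n) tangent_fun \<Rightarrow> bool" where
  "kropina_metric X \<A> C m a b F \<longleftrightarrow>
     pseudo_riemannian \<A> (topspace X) a \<and> one_form \<A> (topspace X) b \<and>
     finsler_metric X \<A> C F \<and>
     (\<forall>c\<in>\<A>. \<forall>(x, y)\<in>C c.
        let \<alpha> = sqrt \<bar>y \<bullet> (a c x *v y)\<bar>; \<beta> = b c x \<bullet> y in
        rpow_defined \<alpha> (1 + m) \<and> rpow_defined \<beta> (- m) \<and>
        F c x y = rpow \<alpha> (1 + m) * rpow \<beta> (- m))"

definition kropina_berwald_condition ::
    "'p topology \<Rightarrow> ('p, 'n::finite) chart set \<Rightarrow> real \<Rightarrow>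
     ('p, 'n) tensor2_field \<Rightarrow> ('p, 'n) covector_field \<Rightarrow> ('p, 'n) covector_field \<Rightarrow> bool" where
  "kropina_berwald_condition X \<A> m a b f \<longleftrightarrow>
     (\<forall>c\<in>\<A>. \<forall>x\<in>coords c (topspace X). \<forall>i j.
        cov_deriv (levi_civita (a c)) (b c) x j i =
          m * (f c x \<bullet> (matrix_inv (a c x) *v b c x)) * a c x $ i $ j
          + b c x $ i * f c x $ j - m * f c x $ i * b c x $ j)"

end

(* In a chart, let \<Gamma> be the connection of the informal statement. The Berwald condition says exactly that
   \<nabla>\<^sub>i a = 2 m f\<^sub>i a and \<nabla>\<^sub>i b = (1 + m) f\<^sub>i b. Hence the horizontal derivatives of
   F^2 = |a(y,y)|^(1+m) |b(y)|^(-2m) vanish, the two contributions 2m(1+m) f\<^sub>i cancelling; since \<Gamma> is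
   torsion-free, this forces \<Gamma> to be the affine connection of F. For a torsion-free connection the
   antisymmetric part of the Ricci tensor is the exterior derivative of the trace \<Gamma>\<^sup>i\<^sub>i\<^sub>k. That trace is closed
   for a Levi-Civita connection and equals a closed form minus m n f\<^sub>k here. If f = d\<psi>, the two recurrence
   relations say that exp(-2m\<psi>) a and exp(-(1+m)\<psi>) b are parallel. *)

theory Submission
  imports Defs
begin

section \<open>Calculus of k times differentiable maps\<close>

text \<open>The nonlinear connection contains the inverse of the fundamental tensor, unwieldy for a
  Kropina metric. That inverse is never computed: horizontality writes the bracket it is applied to
  as the fundamental tensor times a spray, and the two matrices cancel. Since
  \<open>affine_connection\<close> is a definite description, uniqueness of the coefficients is
  needed too; it comes from the openness of the fibres. The possible signs of \<open>a(y,y)\<close>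
  and of \<beta>, and integer as well as real exponents, are treated at once by writing
  \<open>F^2\<close> as the exponential of a combination of logarithms of squares. The connection is
  the classical formula for the Levi-Civita connection of a conformally rescaled metric with
  \<open>d\<psi>\<close> replaced by \<open>f\<close>, which makes sense even if \<open>f\<close>
  has no potential; the trace term then records the obstruction. Smoothness means iterated
  directional derivatives. Symmetry of second derivatives is the analytic fact behind both the
  closedness of the Levi-Civita trace and the exchange of base and fibre derivatives of
  \<open>F^2\<close>.\<close>

lemma Ck_on_cong:
  assumes "open S" "\<And>x. x \<in> S \<Longrightarrow> f x = g x" "Ck_on k S f"
  shows "Ck_on k S g"
  using assms(2,3)
proof (induction k arbitrary: f g)
  case 0
  then show ?case using continuous_on_cong[of S S f g] by simp
next
  case (Suc k)
  have eq: "frechet_derivative f (at x) v = frechet_derivative g (at x) v" if "x \<in> S" for x v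
    using frechet_derivative_transform_within_open[of f x S g] Suc.prems that assms(1) by auto
  have "g differentiable (at x)" if "x \<in> S" for x
  proof -
    have "(f has_derivative frechet_derivative f (at x)) (at x)"
      using Suc.prems that by (simp add: frechet_derivative_works[symmetric])
    from has_derivative_transform_within_open[OF this assms(1) that, of g] Suc.prems(1)
    show ?thesis by (auto simp: differentiable_def)
  qed
  moreover have "Ck_on k S (\<lambda>x. frechet_derivative g (at x) v)" for v
    using Suc.IH[of "\<lambda>x. frechet_derivative f (at x) v" "\<lambda>x. frechet_derivative g (at x) v"]
      eq Suc.prems(2) by simp
  ultimately show ?case by simp
qed

lemma Ck_on_SucD: "Ck_on (Suc k) S f \<Longrightarrow> Ck_on k S f"
proof (induction k arbitrary: f)
  case 0
  then show ?case
    by (simp add: differentiable_at_withinI differentiable_imp_continuous_on differentiable_on_def)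
next
  case (Suc k)
  then have "\<forall>v. Ck_on k S (\<lambda>x. frechet_derivative f (at x) v)"
    unfolding Ck_on.simps(2)[of "Suc k"] by blast
  with Suc.prems show ?case by simp
qed

lemma Ck_on_bounded_linear:
  assumes "open S" "bounded_linear h" "Ck_on k S f"
  shows "Ck_on k S (\<lambda>x. h (f x))"
  using assms(3)
proof (induction k arbitrary: f)
  case 0
  then show ?case by (auto intro: bounded_linear.continuous_on[OF assms(2)])
next
  case (Suc k)
  have hd: "((\<lambda>x. h (f x)) has_derivative (\<lambda>v. h (frechet_derivative f (at x) v))) (at x)"
    if "x \<in> S" for x
    using Suc.prems that bounded_linear.has_derivative[OF assms(2)] frechet_derivative_works by fastforce
  have "Ck_on k S (\<lambda>x. frechet_derivative (\<lambda>x. h (f x)) (at x) v)" for v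
  proof (rule Ck_on_cong[OF assms(1)])
    show "Ck_on k S (\<lambda>x. h (frechet_derivative f (at x) v))"
      using Suc.prems Suc.IH[of "\<lambda>x. frechet_derivative f (at x) v"] by simp
  qed (simp add: frechet_derivative_at[OF hd, symmetric])
  then show ?case using hd by (auto simp: differentiable_def)
qed

lemma Ck_on_add:
  assumes "open S" "Ck_on k S f" "Ck_on k S g"
  shows "Ck_on k S (\<lambda>x. f x + g x)"
  using assms(2,3)
proof (induction k arbitrary: f g)
  case 0
  then show ?case by (auto intro: continuous_intros)
next
  case (Suc k)
  have hd: "((\<lambda>x. f x + g x) has_derivative
      (\<lambda>v. frechet_derivative f (at x) v + frechet_derivative g (at x) v)) (at x)"
    if "x \<in> S" for x
    using Suc.prems that by (intro has_derivative_add) (auto simp: frechet_derivative_works[symmetric])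
  have "Ck_on k S (\<lambda>x. frechet_derivative (\<lambda>x. f x + g x) (at x) v)" for v
  proof (rule Ck_on_cong[OF assms(1)])
    show "Ck_on k S (\<lambda>x. frechet_derivative f (at x) v + frechet_derivative g (at x) v)"
      using Suc.prems
        Suc.IH[of "\<lambda>x. frechet_derivative f (at x) v" "\<lambda>x. frechet_derivative g (at x) v"]
      by simp
  qed (simp add: frechet_derivative_at[OF hd, symmetric])
  then show ?case using hd by (auto simp: differentiable_def)
qed

text \<open>A general bounded bilinear \<open>p\<close> covers real multiplication as well as
  scaling of vectors and matrices. Each summand of the product rule keeps one factor
  undifferentiated, so the induction also needs \<open>f\<close> and \<open>g\<close> themselves one
  order lower.\<close>

lemma Ck_on_bilinear:
  assumes "open S" "bounded_bilinear p" "Ck_on k S f" "Ck_on k S g"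
  shows "Ck_on k S (\<lambda>x. p (f x) (g x))"
  using assms(3,4)
proof (induction k arbitrary: f g)
  case 0
  then show ?case by (auto intro: bounded_bilinear.continuous_on[OF assms(2)])
next
  case (Suc k)
  have hd: "((\<lambda>x. p (f x) (g x)) has_derivative
      (\<lambda>v. p (f x) (frechet_derivative g (at x) v) + p (frechet_derivative f (at x) v) (g x))) (at x)"
    if "x \<in> S" for x
    using Suc.prems that
    by (intro bounded_bilinear.FDERIV[OF assms(2)]) (auto simp: frechet_derivative_works[symmetric])
  have "Ck_on k S (\<lambda>x. frechet_derivative (\<lambda>x. p (f x) (g x)) (at x) v)" for v
  proof (rule Ck_on_cong[OF assms(1)])
    show "Ck_on k S (\<lambda>x. p (f x) (frechet_derivative g (at x) v)
        + p (frechet_derivative f (at x) v) (g x))"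
      using Suc.prems Ck_on_SucD[OF Suc.prems(1)] Ck_on_SucD[OF Suc.prems(2)]
      by (intro Ck_on_add[OF assms(1)] Suc.IH) auto
  qed (simp add: frechet_derivative_at[OF hd, symmetric])
  then show ?case using hd by (auto simp: differentiable_def)
qed

text \<open>The derivative contains \<open>exp (u x)\<close> again, so the induction closes on the
  same \<open>u\<close>.\<close>

lemma Ck_on_exp:
  fixes u :: "'a::real_normed_vector \<Rightarrow> real"
  assumes "open S" "Ck_on k S u"
  shows "Ck_on k S (\<lambda>x. exp (u x))"
  using assms(2)
proof (induction k)
  case 0
  then show ?case by (auto intro: continuous_intros)
next
  case (Suc k)
  have hd: "((\<lambda>x. exp (u x)) has_derivative
      (\<lambda>v. frechet_derivative u (at x) v * exp (u x))) (at x)"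
    if "x \<in> S" for x
    using Suc.prems that by (intro has_derivative_exp) (auto simp: frechet_derivative_works[symmetric])
  have "Ck_on k S (\<lambda>x. frechet_derivative (\<lambda>x. exp (u x)) (at x) v)" for v
  proof (rule Ck_on_cong[OF assms(1)])
    show "Ck_on k S (\<lambda>x. frechet_derivative u (at x) v * exp (u x))"
      using Suc.prems Suc.IH Ck_on_SucD[OF Suc.prems]
      by (intro Ck_on_bilinear[OF assms(1) bounded_bilinear_mult]) auto
  qed (simp add: frechet_derivative_at[OF hd, symmetric])
  then show ?case using hd by (auto simp: differentiable_def)
qed

section \<open>Symmetry of second derivatives\<close>

lemma has_real_derivative_along_line:
  fixes f :: "'a::real_normed_vector \<Rightarrow> real"
  assumes "f differentiable (at (z + s *\<^sub>R u))"
  shows "((\<lambda>s. f (z + s *\<^sub>R u)) has_real_derivative frechet_derivative f (at (z + s *\<^sub>R u)) u) (at s)"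
proof -
  have f: "(f has_derivative frechet_derivative f (at (z + s *\<^sub>R u))) (at (z + s *\<^sub>R u))"
    using assms frechet_derivative_works by blast
  have "((\<lambda>s. z + s *\<^sub>R u) has_derivative (\<lambda>t. t *\<^sub>R u)) (at s)"
    by (auto intro!: derivative_eq_intros)
  from has_derivative_compose[OF this f]
  have "((\<lambda>s. f (z + s *\<^sub>R u)) has_derivative (\<lambda>t. frechet_derivative f (at (z + s *\<^sub>R u)) (t *\<^sub>R u))) (at s)" .
  moreover have "frechet_derivative f (at (z + s *\<^sub>R u)) (t *\<^sub>R u) = frechet_derivative f (at (z + s *\<^sub>R u)) u * t" for t
    using linear_cmul[OF linear_frechet_derivative[OF assms]] by simp
  ultimately show ?thesis by (simp add: has_field_derivative_def)
qed

text \<open>The mean value theorem is applied twice: along \<open>u\<close> to the increment of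
  \<open>f\<close> in direction \<open>v\<close>, then along \<open>v\<close> to the directional
  derivative \<open>D\<close>. Exchanging \<open>u\<close> and \<open>v\<close> expresses the same
  second difference through the other mixed derivative.\<close>

lemma second_difference_mean_value:
  fixes f :: "'a::real_normed_vector \<Rightarrow> real"
  assumes "Ck_on 2 S f" "h > 0"
    and S: "\<And>s t. 0 \<le> s \<Longrightarrow> s \<le> h \<Longrightarrow> 0 \<le> t \<Longrightarrow> t \<le> h \<Longrightarrow> x + s *\<^sub>R u + t *\<^sub>R v \<in> S"
  shows "\<exists>s t. 0 < s \<and> s < h \<and> 0 < t \<and> t < h \<and>
    f (x + h *\<^sub>R u + h *\<^sub>R v) - f (x + h *\<^sub>R u) - f (x + h *\<^sub>R v) + f x
      = h * (h * frechet_derivative (\<lambda>x. frechet_derivative f (at x) u) (at (x + s *\<^sub>R u + t *\<^sub>R v)) v)"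
proof -
  define D where "D = (\<lambda>x. frechet_derivative f (at x) u)"
  have f: "f differentiable (at z)" and D: "D differentiable (at z)" if "z \<in> S" for z
    using assms(1) that by (auto simp: numeral_2_eq_2 D_def)
  have 1: "((\<lambda>s. f ((x + h *\<^sub>R v) + s *\<^sub>R u) - f (x + s *\<^sub>R u)) has_real_derivative
      D ((x + h *\<^sub>R v) + s *\<^sub>R u) - D (x + s *\<^sub>R u)) (at s)" if "0 \<le> s" "s \<le> h" for s
    unfolding D_def
    using S[OF that, of h] S[OF that, of 0] assms(2)
    by (intro DERIV_diff has_real_derivative_along_line f) (auto simp: algebra_simps)
  obtain s where s: "0 < s" "s < h"
    "(f ((x + h *\<^sub>R v) + h *\<^sub>R u) - f (x + h *\<^sub>R u)) - (f ((x + h *\<^sub>R v) + 0 *\<^sub>R u) - f (x + 0 *\<^sub>R u))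
      = (h - 0) * (D ((x + h *\<^sub>R v) + s *\<^sub>R u) - D (x + s *\<^sub>R u))"
    using MVT2[OF assms(2) 1] by blast
  have 2: "((\<lambda>t. D ((x + s *\<^sub>R u) + t *\<^sub>R v)) has_real_derivative
      frechet_derivative D (at ((x + s *\<^sub>R u) + t *\<^sub>R v)) v) (at t)" if "0 \<le> t" "t \<le> h" for t
    using S[of s t] s that by (intro has_real_derivative_along_line D) auto
  obtain t where t: "0 < t" "t < h"
    "D ((x + s *\<^sub>R u) + h *\<^sub>R v) - D ((x + s *\<^sub>R u) + 0 *\<^sub>R v) = (h - 0) * frechet_derivative D (at ((x + s *\<^sub>R u) + t *\<^sub>R v)) v"
    using MVT2[OF assms(2) 2] by blast
  show ?thesis
    using s t unfolding D_def[symmetric]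
    by (intro exI[of _ s] exI[of _ t]) (simp add: algebra_simps)
qed

text \<open>Schwarz's theorem. The second difference is symmetric in \<open>u\<close> and
  \<open>v\<close>, so one mixed derivative at some point near \<open>x\<close> equals the other one
  at another point near \<open>x\<close>; by continuity no gap can remain at \<open>x\<close>
  itself.\<close>

lemma frechet_derivative_commute:
  fixes f :: "'a::real_normed_vector \<Rightarrow> real"
  assumes "open S" "Ck_on 2 S f" "x \<in> S"
  shows "frechet_derivative (\<lambda>x. frechet_derivative f (at x) u) (at x) v
       = frechet_derivative (\<lambda>x. frechet_derivative f (at x) v) (at x) u" (is "?L x = ?R x")
proof (rule ccontr)
  assume ne: "?L x \<noteq> ?R x"
  \<comment> \<open>Half the gap: two errors strictly below \<open>e\<close> cannot bridge
    it.\<close>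
  define e where "e = \<bar>?L x - ?R x\<bar> / 2"
  have e: "e > 0" using ne by (simp add: e_def)
  have cL: "continuous_on S ?L" and cR: "continuous_on S ?R"
    using assms(2) by (auto simp: numeral_2_eq_2)
  obtain d0 where d0: "d0 > 0" "ball x d0 \<subseteq> S" using assms openE by blast
  obtain d1 where d1: "d1 > 0" "\<And>y. y \<in> S \<Longrightarrow> dist y x < d1 \<Longrightarrow> dist (?L y) (?L x) < e"
    using cL assms(3) e by (meson continuous_on_iff)
  obtain d2 where d2: "d2 > 0" "\<And>y. y \<in> S \<Longrightarrow> dist y x < d2 \<Longrightarrow> dist (?R y) (?R x) < e"
    using cR assms(3) e by (meson continuous_on_iff)
  define d where "d = min d0 (min d1 d2)"
  \<comment> \<open>This size keeps the parallelogram spanned by \<open>h *\<^sub>R u\<close> and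
    \<open>h *\<^sub>R v\<close> within \<open>d / 2\<close> of \<open>x\<close>; the summand 1
    keeps the denominator positive.\<close>
  define h where "h = d / (2 * (norm u + norm v + 1))"
  have d: "d > 0" using d0 d1 d2 by (simp add: d_def)
  have n: "norm u + norm v + 1 > 0" by (smt (verit) norm_ge_zero)
  have h: "h > 0" using d n by (simp add: h_def)
  have small: "norm (s *\<^sub>R u + t *\<^sub>R v) < d" if "0 \<le> s" "s \<le> h" "0 \<le> t" "t \<le> h" for s t
  proof -
    have "norm (s *\<^sub>R u + t *\<^sub>R v) \<le> s * norm u + t * norm v"
      using norm_triangle_ineq[of "s *\<^sub>R u" "t *\<^sub>R v"] that by simp
    also have "\<dots> \<le> h * norm u + h * norm v"
      using that by (intro add_mono mult_right_mono) auto
    also have "\<dots> \<le> h * (norm u + norm v + 1)" using h by (simp add: algebra_simps)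
    also have "\<dots> = d / 2" using n by (simp add: h_def field_simps)
    finally show ?thesis using d by simp
  qed
  have near: "x + s *\<^sub>R u + t *\<^sub>R v \<in> S \<and> dist (x + s *\<^sub>R u + t *\<^sub>R v) x < d1 \<and> dist (x + s *\<^sub>R u + t *\<^sub>R v) x < d2"
    if "0 \<le> s" "s \<le> h" "0 \<le> t" "t \<le> h" for s t
  proof -
    have "dist (x + s *\<^sub>R u + t *\<^sub>R v) x < d"
      using small[OF that] by (simp add: dist_norm add.assoc)
    then show ?thesis using d0 by (auto simp: d_def dist_commute)
  qed
  have "\<exists>s t. 0 < s \<and> s < h \<and> 0 < t \<and> t < h \<and>
    f (x + h *\<^sub>R u + h *\<^sub>R v) - f (x + h *\<^sub>R u) - f (x + h *\<^sub>R v) + f x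
      = h * (h * ?L (x + s *\<^sub>R u + t *\<^sub>R v))"
    by (rule second_difference_mean_value[OF assms(2) h]) (simp add: near)
  then obtain s t where 1: "0 < s" "s < h" "0 < t" "t < h"
    "f (x + h *\<^sub>R u + h *\<^sub>R v) - f (x + h *\<^sub>R u) - f (x + h *\<^sub>R v) + f x
      = h * (h * ?L (x + s *\<^sub>R u + t *\<^sub>R v))"
    by auto
  have near': "x + s *\<^sub>R v + t *\<^sub>R u \<in> S" if "0 \<le> s" "s \<le> h" "0 \<le> t" "t \<le> h" for s t
    using near[of t s] that by (simp add: add.assoc add.commute[of "s *\<^sub>R v"])
  have "\<exists>s t. 0 < s \<and> s < h \<and> 0 < t \<and> t < h \<and>
    f (x + h *\<^sub>R v + h *\<^sub>R u) - f (x + h *\<^sub>R v) - f (x + h *\<^sub>R u) + f x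
      = h * (h * ?R (x + s *\<^sub>R v + t *\<^sub>R u))"
    by (rule second_difference_mean_value[OF assms(2) h]) (simp add: near')
  then obtain s' t' where 2: "0 < s'" "s' < h" "0 < t'" "t' < h"
    "f (x + h *\<^sub>R v + h *\<^sub>R u) - f (x + h *\<^sub>R v) - f (x + h *\<^sub>R u) + f x
      = h * (h * ?R (x + s' *\<^sub>R v + t' *\<^sub>R u))"
    by auto
  have "f (x + h *\<^sub>R u + h *\<^sub>R v) = f (x + h *\<^sub>R v + h *\<^sub>R u)" by (simp add: algebra_simps)
  then have "h * (h * ?L (x + s *\<^sub>R u + t *\<^sub>R v)) = h * (h * ?R (x + s' *\<^sub>R v + t' *\<^sub>R u))"
    using 1(5) 2(5) by linarith
  then have eq: "?L (x + s *\<^sub>R u + t *\<^sub>R v) = ?R (x + t' *\<^sub>R u + s' *\<^sub>R v)"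
    using h by (simp add: add.assoc add.commute[of "s' *\<^sub>R v"])
  have "dist (?L (x + s *\<^sub>R u + t *\<^sub>R v)) (?L x) < e" "dist (?R (x + t' *\<^sub>R u + s' *\<^sub>R v)) (?R x) < e"
    using near[of s t] near[of t' s'] d1(2) d2(2) 1 2 by auto
  then show False using eq by (simp add: e_def dist_real_def abs_if split: if_splits)
qed

section \<open>Coordinate partial derivatives\<close>

lemma pd_eqI: "(f has_derivative D) (at x) \<Longrightarrow> pd i f x = D (axis i 1)"
  by (simp add: pd_def frechet_derivative_at[symmetric])

text \<open>Both functions have the same derivatives at \<open>x\<close>, if any, so the choice made
  by \<open>frechet_derivative\<close> is the same too. Nested \<open>pd\<close> can thus be
  rewritten before differentiability is known.\<close>

lemma pd_cong:
  assumes "open S" "x \<in> S" "\<And>y. y \<in> S \<Longrightarrow> f y = g y"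
  shows "pd i f x = pd i g x"
proof -
  have "(f has_derivative D) (at x) \<longleftrightarrow> (g has_derivative D) (at x)" for D
    using has_derivative_transform_within_open[OF _ assms(1,2), of f D UNIV g]
      has_derivative_transform_within_open[OF _ assms(1,2), of g D UNIV f] assms(3) by auto
  then show ?thesis by (simp add: pd_def frechet_derivative_def)
qed

lemma pd_const [simp]: "pd i (\<lambda>x. c) x = 0"
  by (simp add: pd_def)

lemma pd_diff:
  assumes "f differentiable (at x)" "g differentiable (at x)"
  shows "pd i (\<lambda>x. f x - g x) x = pd i f x - pd i g x"
  using pd_eqI[OF has_derivative_diff[OF assms[unfolded frechet_derivative_works]], of i]
  by (simp add: pd_def)

lemma pd_mult:
  assumes "f differentiable (at x)" "g differentiable (at x)"
  shows "pd i (\<lambda>x. f x * g x) x = f x * pd i g x + pd i f x * g x"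
  using pd_eqI[OF has_derivative_mult[OF assms[unfolded frechet_derivative_works]], of i]
  by (simp add: pd_def)

lemma pd_cmult: "f differentiable (at x) \<Longrightarrow> pd i (\<lambda>x. c * f x) x = c * pd i f x"
  using pd_mult[of "\<lambda>_. c" x f i] by simp

lemma pd_sum:
  assumes "\<And>j. j \<in> J \<Longrightarrow> f j differentiable (at x)"
  shows "pd i (\<lambda>x. \<Sum>j\<in>J. f j x) x = (\<Sum>j\<in>J. pd i (f j) x)"
  using pd_eqI[OF has_derivative_sum[OF assms[unfolded frechet_derivative_works]], where i=i]
  by (simp add: pd_def)

lemma smooth_on_differentiable: "smooth_on S f \<Longrightarrow> x \<in> S \<Longrightarrow> f differentiable (at x)"
  unfolding smooth_on_def by (drule spec[of _ "Suc 0"]) simp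

lemma smooth_on_pd: "smooth_on S f \<Longrightarrow> smooth_on S (pd i f)"
  unfolding smooth_on_def pd_def by (rule allI, drule_tac x="Suc k" in spec) simp

lemma smooth_on_vec_nth: "open S \<Longrightarrow> smooth_on S f \<Longrightarrow> smooth_on S (\<lambda>x. f x $ i)"
  by (simp add: smooth_on_def Ck_on_bounded_linear[OF _ bounded_linear_vec_nth])

lemma smooth_on_mult:
  fixes f g :: "'a::real_normed_vector \<Rightarrow> real"
  shows "open S \<Longrightarrow> smooth_on S f \<Longrightarrow> smooth_on S g \<Longrightarrow> smooth_on S (\<lambda>x. f x * g x)"
  by (simp add: smooth_on_def Ck_on_bilinear[OF _ bounded_bilinear_mult])

lemma smooth_on_exp_scaleR:
  fixes u :: "'a::real_normed_vector \<Rightarrow> real"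
  assumes "open S" "smooth_on S u" "smooth_on S g"
  shows "smooth_on S (\<lambda>x. exp (c * u x) *\<^sub>R g x)"
  unfolding smooth_on_def
proof
  fix k
  have "Ck_on k S (\<lambda>x. c * u x)"
    using Ck_on_bounded_linear[OF assms(1) bounded_linear_mult_right, of k u c] assms(2)
    by (simp add: smooth_on_def)
  from Ck_on_exp[OF assms(1) this] show "Ck_on k S (\<lambda>x. exp (c * u x) *\<^sub>R g x)"
    using assms(3) by (intro Ck_on_bilinear[OF assms(1) bounded_bilinear_scaleR]) (simp_all add: smooth_on_def)
qed

lemma pd_commute:
  assumes "open S" "smooth_on S f" "x \<in> S"
  shows "pd i (pd j f) x = pd j (pd i f) x"
  unfolding pd_def
  using assms(2) by (intro frechet_derivative_commute[OF assms(1) _ assms(3)]) (simp add: smooth_on_def)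

section \<open>The inverse of a matrix-valued map\<close>

lemma matrix_inv_left: "invertible (A::real^'n^'n) \<Longrightarrow> matrix_inv A ** A = mat 1"
  and matrix_inv_right: "invertible (A::real^'n^'n) \<Longrightarrow> A ** matrix_inv A = mat 1"
  unfolding invertible_def matrix_inv_def by (rule someI2_ex, blast, blast)+

lemma sum_matrix_inv_left:
  "invertible (A::real^'n^'n) \<Longrightarrow> (\<Sum>k\<in>UNIV. matrix_inv A $ i $ k * A $ k $ j) = (if i = j then 1 else 0)"
  using matrix_inv_left[of A] by (simp add: matrix_matrix_mult_def mat_def vec_eq_iff)

lemma sum_matrix_inv_right:
  "invertible (A::real^'n^'n) \<Longrightarrow> (\<Sum>k\<in>UNIV. A $ i $ k * matrix_inv A $ k $ j) = (if i = j then 1 else 0)"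
  using matrix_inv_right[of A] by (simp add: matrix_matrix_mult_def mat_def vec_eq_iff)

lemma matrix_inv_symmetric:
  assumes "invertible (A::real^'n^'n)" "transpose A = A"
  shows "matrix_inv A $ i $ j = matrix_inv A $ j $ i"
proof -
  have "transpose (matrix_inv A) = transpose (matrix_inv A) ** (A ** matrix_inv A)"
    using assms(1) by (simp add: matrix_inv_right)
  also have "\<dots> = transpose (A ** matrix_inv A) ** matrix_inv A"
    by (simp add: matrix_mul_assoc matrix_transpose_mul assms(2))
  also have "\<dots> = matrix_inv A"
    using assms(1) by (simp add: matrix_inv_right)
  finally have "transpose (matrix_inv A) $ j $ i = matrix_inv A $ j $ i" by simp
  then show ?thesis by (simp add: transpose_def)
qed

lemma differentiable_prod:
  fixes f :: "'i \<Rightarrow> 'a::real_normed_vector \<Rightarrow> real"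
  assumes "\<And>i. i \<in> I \<Longrightarrow> f i differentiable (at x)"
  shows "(\<lambda>x. \<Prod>i\<in>I. f i x) differentiable (at x)"
  using assms by (induction I rule: infinite_finite_induct) (auto intro: differentiable_mult)

lemma differentiable_det:
  fixes B :: "'a::real_normed_vector \<Rightarrow> real^'n^'n"
  assumes "\<And>i j. (\<lambda>x. B x $ i $ j) differentiable (at x)"
  shows "(\<lambda>x. det (B x)) differentiable (at x)"
  unfolding det_def
  by (intro differentiable_sum ballI differentiable_mult differentiable_const differentiable_prod assms)
     (simp_all add: finite_permutations)

text \<open>Entries of the inverse become quotients of determinants, hence of polynomials in the
  entries of \<open>A\<close>; differentiability of the inverse follows from this.\<close>

lemma matrix_inv_cramer:
  assumes "invertible (A::real^'n^'n)"
  shows "matrix_inv A $ i $ j = det (\<chi> p q. if q = i then axis j 1 $ p else A $ p $ q) / det A"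
proof -
  have "A *v (matrix_inv A *v axis j 1) = axis j 1"
    using assms by (simp add: matrix_vector_mul_assoc matrix_inv_right)
  then have "matrix_inv A *v axis j 1 = (\<chi> k. det (\<chi> p q. if q = k then axis j 1 $ p else A $ p $ q) / det A)"
    using cramer[of A] assms by (simp add: invertible_det_nz)
  then have "(matrix_inv A *v axis j 1) $ i = det (\<chi> p q. if q = i then axis j 1 $ p else A $ p $ q) / det A"
    by simp
  then show ?thesis by (simp add: matrix_vector_mult_basis column_def)
qed

lemma differentiable_matrix_inv:
  fixes B :: "'a::real_normed_vector \<Rightarrow> real^'n^'n"
  assumes "open S" "x \<in> S" "\<And>y. y \<in> S \<Longrightarrow> invertible (B y)"
    and "\<And>i j. (\<lambda>x. B x $ i $ j) differentiable (at x)"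
  shows "(\<lambda>x. matrix_inv (B x) $ i $ j) differentiable (at x)"
proof -
  have "(\<lambda>x. if q = i then axis j 1 $ p else B x $ p $ q) differentiable (at x)" for p q
    using assms(4) by (cases "q = i") auto
  then have "(\<lambda>x. det (\<chi> p q. if q = i then axis j 1 $ p else B x $ p $ q) / det (B x)) differentiable (at x)"
    using assms by (intro differentiable_divide differentiable_det) (auto simp: invertible_det_nz)
  then show ?thesis
    unfolding differentiable_def
    using has_derivative_transform_within_open[OF _ assms(1,2)] matrix_inv_cramer[OF assms(3)]
    by (metis (no_types, lifting))
qed

text \<open>Differentiate the identity that inverse times matrix is 1, then multiply by the inverse
  from the right.\<close>

lemma pd_matrix_inv:
  fixes B :: "real^'n \<Rightarrow> real^'m^'m"
  assumes "open S" "x \<in> S" "\<And>y. y \<in> S \<Longrightarrow> invertible (B y)"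
    and d: "\<And>i j. (\<lambda>x. B x $ i $ j) differentiable (at x)"
  shows "pd k (\<lambda>x. matrix_inv (B x) $ i $ q) x =
    - (\<Sum>p\<in>UNIV. \<Sum>j\<in>UNIV. matrix_inv (B x) $ i $ p * pd k (\<lambda>x. B x $ p $ j) x * matrix_inv (B x) $ j $ q)"
proof -
  let ?I = "\<lambda>x i j. matrix_inv (B x) $ i $ j"
  note di = differentiable_matrix_inv[OF assms(1-3) d]
  have 0: "(\<Sum>p\<in>UNIV. pd k (\<lambda>x. ?I x i p) x * B x $ p $ j)
      = - (\<Sum>p\<in>UNIV. ?I x i p * pd k (\<lambda>x. B x $ p $ j) x)" for j
  proof -
    have "pd k (\<lambda>x. \<Sum>p\<in>UNIV. ?I x i p * B x $ p $ j) x = pd k (\<lambda>x. if i = j then 1 else 0) x"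
      using assms by (intro pd_cong) (auto simp: sum_matrix_inv_left)
    then show ?thesis
      by (simp add: pd_sum pd_mult di d sum.distrib add_eq_0_iff)
  qed
  have "pd k (\<lambda>x. ?I x i q) x = (\<Sum>p\<in>UNIV. pd k (\<lambda>x. ?I x i p) x * (\<Sum>j\<in>UNIV. B x $ p $ j * ?I x j q))"
    using assms(2,3) by (simp add: sum_matrix_inv_right if_distrib[of "\<lambda>t. _ * t"] cong: if_cong)
  also have "\<dots> = (\<Sum>j\<in>UNIV. (\<Sum>p\<in>UNIV. pd k (\<lambda>x. ?I x i p) x * B x $ p $ j) * ?I x j q)"
    by (simp add: sum_distrib_left sum_distrib_right mult.assoc) (rule sum.swap)
  also have "\<dots> = - (\<Sum>p\<in>UNIV. \<Sum>j\<in>UNIV. ?I x i p * pd k (\<lambda>x. B x $ p $ j) x * ?I x j q)"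
    unfolding 0 by (simp add: sum_distrib_right sum_negf) (rule sum.swap)
  finally show ?thesis .
qed

section \<open>The Ricci tensor of a torsion-free connection\<close>

text \<open>Torsion-freeness makes three of the four terms of the contracted curvature symmetric in
  \<open>l\<close> and \<open>k\<close>: the divergence of \<open>\<Gamma>\<close>, the product with
  its trace, and the full contraction of two copies of \<open>\<Gamma>\<close>. Only the derivative
  of the trace survives.\<close>

lemma ricci_antisymmetric_part:
  assumes "open S" "x \<in> S" "\<And>y k i j. y \<in> S \<Longrightarrow> \<Gamma> y k i j = \<Gamma> y k j i"
    and d: "\<And>k i j. (\<lambda>y. \<Gamma> y k i j) differentiable (at x)"
  shows "ricci \<Gamma> x l k - ricci \<Gamma> x k l
    = pd l (\<lambda>y. \<Sum>i\<in>UNIV. \<Gamma> y i i k) x - pd k (\<lambda>y. \<Sum>i\<in>UNIV. \<Gamma> y i i l) x"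
proof -
  have 1: "pd i (\<lambda>y. \<Gamma> y i k l) x = pd i (\<lambda>y. \<Gamma> y i l k) x" for i
    using assms by (intro pd_cong) auto
  \<comment> \<open>Exchanging the names \<open>i\<close> and \<open>m\<close> and then the lower
    indices turns one side into the other.\<close>
  have 2: "(\<Sum>i\<in>UNIV. \<Sum>m\<in>UNIV. \<Gamma> x i k m * \<Gamma> x m i l) = (\<Sum>i\<in>UNIV. \<Sum>m\<in>UNIV. \<Gamma> x i l m * \<Gamma> x m i k)"
    by (subst sum.swap) (simp add: assms(3)[OF assms(2), of _ _ k] assms(3)[OF assms(2), of _ _ l] mult.commute)
  have 3: "\<Gamma> x m k l = \<Gamma> x m l k" for m using assms(2,3) by blast
  show ?thesis
    unfolding ricci_def curvature_def
    by (simp add: pd_sum d 1 2 3 sum.distrib sum_subtractf)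
qed

section \<open>The trace of a Levi-Civita connection\<close>

lemma levi_civita_symmetric:
  assumes "open S" "x \<in> S" "\<And>y. y \<in> S \<Longrightarrow> transpose (a y) = a y"
  shows "levi_civita a x k i j = levi_civita a x k j i"
proof -
  have "pd l (\<lambda>x. a x $ i $ j) x = pd l (\<lambda>x. a x $ j $ i) x" for l
    using assms by (intro pd_cong) (auto simp: transpose_def vec_eq_iff)
  then show ?thesis by (simp add: levi_civita_def add.commute)
qed

lemma levi_civita_differentiable:
  assumes "open S" "x \<in> S" "smooth_on S a" "\<And>y. y \<in> S \<Longrightarrow> invertible (a y)"
  shows "(\<lambda>x. levi_civita a x k i j) differentiable (at x)"
proof -
  have s: "smooth_on S (\<lambda>x. a x $ i $ j)" for i j
    using assms by (intro smooth_on_vec_nth)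
  note d = smooth_on_differentiable[OF s assms(2)] smooth_on_differentiable[OF smooth_on_pd[OF s] assms(2)]
  show ?thesis
    unfolding levi_civita_def
    by (intro differentiable_mult differentiable_const differentiable_sum ballI differentiable_add
        differentiable_diff differentiable_matrix_inv[OF assms(1,2,4)] d) simp_all
qed

text \<open>The right-hand side is the derivative of the logarithm of
  \<open>sqrt \<bar>det a\<bar>\<close>. The other two terms of the Christoffel symbol cancel
  because the inverse metric is symmetric.\<close>

lemma levi_civita_trace:
  assumes "open S" "x \<in> S" "\<And>y. y \<in> S \<Longrightarrow> transpose (a y) = a y \<and> invertible (a y)"
  shows "(\<Sum>i\<in>UNIV. levi_civita a x i i k)
    = (1/2) * (\<Sum>i\<in>UNIV. \<Sum>p\<in>UNIV. matrix_inv (a x) $ i $ p * pd k (\<lambda>x. a x $ i $ p) x)"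
proof -
  let ?I = "\<lambda>i j. matrix_inv (a x) $ i $ j"
  have s: "pd l (\<lambda>x. a x $ i $ j) x = pd l (\<lambda>x. a x $ j $ i) x" for l i j
    using assms by (intro pd_cong) (auto simp: transpose_def vec_eq_iff)
  have Is: "?I i j = ?I j i" for i j
    using assms by (intro matrix_inv_symmetric) auto
  have c: "(\<Sum>i\<in>UNIV. \<Sum>p\<in>UNIV. ?I i p * pd i (\<lambda>x. a x $ p $ k) x)
      = (\<Sum>i\<in>UNIV. \<Sum>p\<in>UNIV. ?I i p * pd p (\<lambda>x. a x $ i $ k) x)"
    by (subst sum.swap) (simp add: Is)
  have "(\<Sum>i\<in>UNIV. levi_civita a x i i k)
    = (1/2) * (\<Sum>i\<in>UNIV. \<Sum>p\<in>UNIV. ?I i p * pd i (\<lambda>x. a x $ p $ k) x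
        + ?I i p * pd k (\<lambda>x. a x $ p $ i) x - ?I i p * pd p (\<lambda>x. a x $ i $ k) x)"
    unfolding levi_civita_def sum_distrib_left[symmetric] distrib_left right_diff_distrib by (rule refl)
  also have "\<dots> = (1/2) * (\<Sum>i\<in>UNIV. \<Sum>p\<in>UNIV. ?I i p * pd k (\<lambda>x. a x $ p $ i) x)"
    using c by (simp add: sum.distrib sum_subtractf)
  finally show ?thesis by (simp add: s[of k])
qed

lemma sum_swap_pairs:
  fixes g :: "'i \<Rightarrow> 'p \<Rightarrow> 'q \<Rightarrow> 'r \<Rightarrow> 'v::comm_monoid_add"
  shows "(\<Sum>i\<in>A. \<Sum>p\<in>B. \<Sum>q\<in>C. \<Sum>r\<in>D. g i p q r) = (\<Sum>q\<in>C. \<Sum>r\<in>D. \<Sum>i\<in>A. \<Sum>p\<in>B. g i p q r)"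
proof -
  have "(\<Sum>i\<in>A. \<Sum>p\<in>B. \<Sum>q\<in>C. \<Sum>r\<in>D. g i p q r) = (\<Sum>i\<in>A. \<Sum>q\<in>C. \<Sum>p\<in>B. \<Sum>r\<in>D. g i p q r)"
    by (intro sum.cong refl sum.swap)
  also have "\<dots> = (\<Sum>q\<in>C. \<Sum>i\<in>A. \<Sum>p\<in>B. \<Sum>r\<in>D. g i p q r)"
    by (rule sum.swap)
  also have "\<dots> = (\<Sum>q\<in>C. \<Sum>i\<in>A. \<Sum>r\<in>D. \<Sum>p\<in>B. g i p q r)"
    by (intro sum.cong refl sum.swap)
  also have "\<dots> = (\<Sum>q\<in>C. \<Sum>r\<in>D. \<Sum>i\<in>A. \<Sum>p\<in>B. g i p q r)"
    by (intro sum.cong refl sum.swap)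
  finally show ?thesis .
qed

text \<open>The trace formula is differentiated directly. The term with second derivatives of
  \<open>a\<close> is symmetric by Schwarz; the derivative of the inverse leaves an expression
  quadratic in first derivatives, symmetric by relabelling.\<close>

lemma levi_civita_trace_closed:
  assumes "open S" "x \<in> S" "smooth_on S a"
    and inv: "\<And>y. y \<in> S \<Longrightarrow> transpose (a y) = a y \<and> invertible (a y)"
  shows "pd l (\<lambda>x. \<Sum>i\<in>UNIV. levi_civita a x i i k) x = pd k (\<lambda>x. \<Sum>i\<in>UNIV. levi_civita a x i i l) x"
proof -
  let ?I = "\<lambda>i j. matrix_inv (a x) $ i $ j"
  let ?d = "\<lambda>l i j. pd l (\<lambda>x. a x $ i $ j) x"
  have s: "smooth_on S (\<lambda>x. a x $ i $ j)" for i j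
    using assms by (intro smooth_on_vec_nth)
  note d = smooth_on_differentiable[OF s assms(2)] smooth_on_differentiable[OF smooth_on_pd[OF s] assms(2)]
  have invs: "\<And>y. y \<in> S \<Longrightarrow> invertible (a y)" using inv by blast
  note di = differentiable_matrix_inv[OF assms(1,2) invs d(1)]
  have Is: "?I i j = ?I j i" for i j
    using assms by (intro matrix_inv_symmetric) auto
  have pI: "pd l (\<lambda>x. matrix_inv (a x) $ i $ p) x = - (\<Sum>q\<in>UNIV. \<Sum>r\<in>UNIV. ?I i q * ?d l q r * ?I r p)" for l i p
    by (rule pd_matrix_inv[OF assms(1,2) invs d(1)])
  define Q where "Q l k = (\<Sum>i\<in>UNIV. \<Sum>p\<in>UNIV. pd l (\<lambda>x. matrix_inv (a x) $ i $ p) x * ?d k i p)" for l k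
  have Q: "Q l k = - (\<Sum>i\<in>UNIV. \<Sum>p\<in>UNIV. \<Sum>q\<in>UNIV. \<Sum>r\<in>UNIV. ?I i q * ?d l q r * ?I r p * ?d k i p)" for l k
    unfolding Q_def pI
    by (simp add: sum_distrib_right sum_negf)
  \<comment> \<open>Relabelling the pair (i, p) as (q, r), together with the symmetry of the inverse
    metric, exchanges \<open>l\<close> and \<open>k\<close>.\<close>
  have "(\<Sum>i\<in>UNIV. \<Sum>p\<in>UNIV. \<Sum>q\<in>UNIV. \<Sum>r\<in>UNIV. ?I i q * ?d l q r * ?I r p * ?d k i p)
     = (\<Sum>i\<in>UNIV. \<Sum>p\<in>UNIV. \<Sum>q\<in>UNIV. \<Sum>r\<in>UNIV. ?I i q * ?d k q r * ?I r p * ?d l i p)"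
    by (subst sum_swap_pairs) (simp add: Is mult_ac)
  then have Qs: "Q l k = Q k l" unfolding Q by simp
  have "pd l (\<lambda>x. \<Sum>i\<in>UNIV. levi_civita a x i i k) x
    = pd l (\<lambda>x. (1/2) * (\<Sum>i\<in>UNIV. \<Sum>p\<in>UNIV. matrix_inv (a x) $ i $ p * pd k (\<lambda>x. a x $ i $ p) x)) x" for l k
    using assms by (intro pd_cong[OF assms(1,2)] levi_civita_trace) auto
  also have "\<dots> l k = (1/2) * (\<Sum>i\<in>UNIV. \<Sum>p\<in>UNIV. pd l (\<lambda>x. matrix_inv (a x) $ i $ p * pd k (\<lambda>x. a x $ i $ p) x) x)" for l k
    by (subst pd_cmult, (intro differentiable_sum ballI differentiable_mult di d; simp), simp add: pd_sum di d)
  also have "\<dots> l k = (1/2) * (Q l k + (\<Sum>i\<in>UNIV. \<Sum>p\<in>UNIV. ?I i p * pd l (pd k (\<lambda>x. a x $ i $ p)) x))" for l k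
    by (simp add: pd_mult di d Q_def sum.distrib)
  finally have R: "pd l (\<lambda>x. \<Sum>i\<in>UNIV. levi_civita a x i i k) x
    = (1/2) * (Q l k + (\<Sum>i\<in>UNIV. \<Sum>p\<in>UNIV. ?I i p * pd l (pd k (\<lambda>x. a x $ i $ p)) x))" for l k .
  show ?thesis
    unfolding R Qs by (simp add: pd_commute[OF assms(1) s assms(2), of l k])
qed

lemma ricci_levi_civita_symmetric:
  assumes "open S" "x \<in> S" "smooth_on S a"
    and "\<And>y. y \<in> S \<Longrightarrow> transpose (a y) = a y \<and> invertible (a y)"
  shows "ricci (levi_civita a) x l k = ricci (levi_civita a) x k l"
proof -
  have "ricci (levi_civita a) x l k - ricci (levi_civita a) x k l = 0"
    using ricci_antisymmetric_part[OF assms(1,2), of "levi_civita a" l k] levi_civita_symmetric[OF assms(1)]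
      levi_civita_differentiable[OF assms(1-3)] levi_civita_trace_closed[OF assms, of l k] assms(4)
    by simp
  then show ?thesis by simp
qed

lemma pd_vec_nth: "pd i (\<lambda>y. y $ j) y = (if j = i then 1 else 0)"
  using pd_eqI[OF bounded_linear_imp_has_derivative[OF bounded_linear_vec_nth[of j]], of i]
  by (simp add: axis_def)

lemma differentiable_vec_nth [simp]: "(\<lambda>y. y $ j) differentiable (at y)"
  using bounded_linear_imp_has_derivative[OF bounded_linear_vec_nth] unfolding differentiable_def by blast

section \<open>The canonical nonlinear connection\<close>

lemma open_Pair_slices:
  assumes "open C"
  shows "open {y. (x, y) \<in> C}" "open {x. (x, y) \<in> C}"
proof -
  have "open ((\<lambda>y. (x, y)) -` C)" "open ((\<lambda>x. (x, y)) -` C)"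
    using assms by (intro open_vimage continuous_intros; simp)+
  then show "open {y. (x, y) \<in> C}" "open {x. (x, y) \<in> C}" by (simp_all add: vimage_def)
qed

text \<open>\<open>F\<close> is jointly smooth, whereas \<open>nonlinear_conn\<close> differentiates
  in \<open>x\<close> and in \<open>y\<close> separately. This translates \<open>pd\<close> into
  directional derivatives on the product, where Schwarz applies.\<close>

lemma differentiable_Pair_slices:
  assumes "g differentiable (at (x, y))"
  shows "(\<lambda>x. g (x, y)) differentiable (at x)" "(\<lambda>y. g (x, y)) differentiable (at y)"
    and "pd i (\<lambda>x. g (x, y)) x = frechet_derivative g (at (x, y)) (axis i 1, 0)"
    and "pd i (\<lambda>y. g (x, y)) y = frechet_derivative g (at (x, y)) (0, axis i 1)"
proof -
  have g: "(g has_derivative frechet_derivative g (at (x, y))) (at (x, y))"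
    using assms frechet_derivative_works by blast
  have "((\<lambda>x. (x, y)) has_derivative (\<lambda>h. (h, 0))) (at x)"
    by (intro has_derivative_Pair has_derivative_ident has_derivative_const)
  note 1 = has_derivative_compose[OF this g]
  have "((\<lambda>y. (x, y)) has_derivative (\<lambda>h. (0, h))) (at y)"
    by (intro has_derivative_Pair has_derivative_ident has_derivative_const)
  note 2 = has_derivative_compose[OF this g]
  show "(\<lambda>x. g (x, y)) differentiable (at x)" "(\<lambda>y. g (x, y)) differentiable (at y)"
    using 1 2 by (auto simp: differentiable_def)
  show "pd i (\<lambda>x. g (x, y)) x = frechet_derivative g (at (x, y)) (axis i 1, 0)"
    using pd_eqI[OF 1] .
  show "pd i (\<lambda>y. g (x, y)) y = frechet_derivative g (at (x, y)) (0, axis i 1)"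
    using pd_eqI[OF 2] .
qed

text \<open>Differentiating the horizontality \<open>\<partial>\<^sub>l F\<^sup>2 = \<Gamma>\<^sup>j\<^sub>l\<^sub>q y\<^sup>q \<partial>F\<^sup>2/\<partial>y\<^sup>j\<close> along \<open>y\<^sup>k\<close> and contracting with
  \<open>y\<^sup>l\<close> gives \<open>y\<^sup>l \<partial>\<^sub>l \<partial>F\<^sup>2/\<partial>y\<^sup>k - \<partial>\<^sub>k F\<^sup>2 = 2 g\<^sub>k\<^sub>j \<Gamma>\<^sup>j\<^sub>l\<^sub>q y\<^sup>l y\<^sup>q\<close>.\<close>

lemma nonlinear_conn_if_horizontal:
  fixes F :: "real^'n \<Rightarrow> real^'n \<Rightarrow> real" and \<Gamma> :: "'n christoffel"
  defines "L \<equiv> \<lambda>p. (F (fst p) (snd p))\<^sup>2"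
  assumes "open C" and C2: "Ck_on 2 C L"
    and sym: "\<And>x y k i j. (x, y) \<in> C \<Longrightarrow> \<Gamma> x k i j = \<Gamma> x k j i"
    and hor: "\<And>x y i. (x, y) \<in> C \<Longrightarrow> frechet_derivative L (at (x, y)) (axis i 1, 0)
      = (\<Sum>j\<in>UNIV. (\<Sum>q\<in>UNIV. \<Gamma> x j i q * y $ q) * frechet_derivative L (at (x, y)) (0, axis j 1))"
    and inv: "\<And>x y. (x, y) \<in> C \<Longrightarrow> invertible (fundamental_tensor F x y)"
    and xy: "(x, y) \<in> C"
  shows "nonlinear_conn F x y k i = (\<Sum>j\<in>UNIV. \<Gamma> x k i j * y $ j)"
proof -
  define Lx where "Lx i = (\<lambda>p. frechet_derivative L (at p) (axis i 1, 0))" for i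
  define Ly where "Ly i = (\<lambda>p. frechet_derivative L (at p) (0, axis i 1))" for i
  define N where "N x y j l = (\<Sum>q\<in>UNIV. \<Gamma> x j l q * y $ q)" for x y j l
  \<comment> \<open>The spray of \<open>\<Gamma>\<close>, quadratic in \<open>y\<close>; twice this
    is the expression whose fibre derivative, divided by 4, is the nonlinear connection.\<close>
  define G where "G y j = (\<Sum>l\<in>UNIV. y $ l * N x y j l)" for y j
  have dL: "L differentiable (at p)" and dLx: "Lx j differentiable (at p)"
    and dLy: "Ly j differentiable (at p)" if "p \<in> C" for p j
    using C2 that by (auto simp: numeral_2_eq_2 Lx_def Ly_def)
  have sl: "open {y. (x, y) \<in> C}" "open {x. (x, y) \<in> C}" for x y
    using open_Pair_slices[OF assms(2)] by auto
  have L1: "pd k (\<lambda>y. (F x y)\<^sup>2) y = Ly k (x, y)" if "(x, y) \<in> C" for x y k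
    using differentiable_Pair_slices(4)[OF dL[OF that]] by (simp add: L_def Ly_def)
  have L2: "pd k (\<lambda>x. (F x y)\<^sup>2) x = Lx k (x, y)" if "(x, y) \<in> C" for x y k
    using differentiable_Pair_slices(3)[OF dL[OF that]] by (simp add: L_def Lx_def)
  have L3: "pd l (\<lambda>x. pd k (\<lambda>y. (F x y)\<^sup>2) y) x = frechet_derivative (Ly k) (at (x, y)) (axis l 1, 0)"
    if "(x, y) \<in> C" for x y k l
  proof -
    have "pd l (\<lambda>x. pd k (\<lambda>y. (F x y)\<^sup>2) y) x = pd l (\<lambda>x. Ly k (x, y)) x"
      using that by (intro pd_cong[OF sl(2)[of y]]) (auto simp: L1)
    then show ?thesis using differentiable_Pair_slices(3)[OF dLy[OF that]] by simp
  qed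
  have L4: "frechet_derivative (Ly j) (at (x, y)) (0, axis i 1) = 2 * fundamental_tensor F x y $ i $ j"
    if "(x, y) \<in> C" for x y i j
  proof -
    have d: "(\<lambda>y. (F x y)\<^sup>2) differentiable (at y)" if "(x, y) \<in> C" for y
      using differentiable_Pair_slices(2)[OF dL[OF that]] by (simp add: L_def)
    have "fundamental_tensor F x y $ i $ j = pd i (\<lambda>y. (1/2) * Ly j (x, y)) y"
      unfolding fundamental_tensor_def vec_lambda_beta
      using that by (intro pd_cong[OF sl(1)[of x]]) (simp_all only: mem_Collect_eq pd_cmult[OF d] L1)
    also have "\<dots> = (1/2) * pd i (\<lambda>y. Ly j (x, y)) y"
      by (rule pd_cmult) (rule differentiable_Pair_slices(2)[OF dLy[OF that]])
    finally show ?thesis using differentiable_Pair_slices(4)[OF dLy[OF that], of i j] by simp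
  qed
  have dN: "(\<lambda>y. N x y j l) differentiable (at y)" and pdN: "pd k (\<lambda>y. N x y j l) y = \<Gamma> x j l k" for x y j l k
    unfolding N_def
    by (auto simp: pd_sum pd_cmult pd_vec_nth if_distrib[of "\<lambda>t. _ * t"] cong: if_cong)
  \<comment> \<open>Once the order of differentiation is exchanged, horizontality can be
    differentiated along the fibre, on which \<open>\<Gamma>\<close> is constant.\<close>
  have L5: "frechet_derivative (Ly k) (at (x, y)) (axis l 1, 0)
      = (\<Sum>j\<in>UNIV. \<Gamma> x j l k * Ly j (x, y) + N x y j l * (2 * fundamental_tensor F x y $ k $ j))"
    if "(x, y) \<in> C" for x y k l
  proof -
    have "frechet_derivative (Ly k) (at (x, y)) (axis l 1, 0) = frechet_derivative (Lx l) (at (x, y)) (0, axis k 1)"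
      unfolding Lx_def Ly_def using assms(2) C2 that by (rule frechet_derivative_commute)
    also have "\<dots> = pd k (\<lambda>y. Lx l (x, y)) y"
      using differentiable_Pair_slices(4)[OF dLx[OF that]] by simp
    also have "\<dots> = pd k (\<lambda>y. \<Sum>j\<in>UNIV. N x y j l * Ly j (x, y)) y"
      using that hor by (intro pd_cong[OF sl(1)[of x]]) (auto simp: Lx_def Ly_def N_def)
    also have "\<dots> = (\<Sum>j\<in>UNIV. \<Gamma> x j l k * Ly j (x, y) + N x y j l * pd k (\<lambda>y. Ly j (x, y)) y)"
      using differentiable_Pair_slices(2)[OF dLy[OF that]]
      by (simp add: pd_sum pd_mult dN pdN add.commute)
    finally show ?thesis
      using differentiable_Pair_slices(4)[OF dLy[OF that]] L4[OF that] by simp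
  qed
  \<comment> \<open>The part of \<open>L5\<close> with an undifferentiated fibre derivative,
    contracted with \<open>y\<close>, is the base derivative of \<open>F^2\<close> by
    torsion-freeness and horizontality; it cancels the subtracted term.\<close>
  have spray: "(\<Sum>l\<in>UNIV. y $ l * pd l (\<lambda>x. pd k (\<lambda>y. (F x y)\<^sup>2) y) x) - pd k (\<lambda>x. (F x y)\<^sup>2) x
      = (\<Sum>j\<in>UNIV. fundamental_tensor F x y $ k $ j * (2 * G y j))" if "(x, y) \<in> C" for y k
  proof -
    have "(\<Sum>l\<in>UNIV. y $ l * (\<Sum>j\<in>UNIV. \<Gamma> x j l k * Ly j (x, y))) = (\<Sum>j\<in>UNIV. N x y j k * Ly j (x, y))"
      unfolding N_def sum_distrib_left sum_distrib_right
      by (subst sum.swap) (simp add: sym[OF that, of _ _ k] mult_ac)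
    moreover have "(\<Sum>l\<in>UNIV. y $ l * (\<Sum>j\<in>UNIV. N x y j l * (2 * fundamental_tensor F x y $ k $ j)))
       = (\<Sum>j\<in>UNIV. fundamental_tensor F x y $ k $ j * (2 * G y j))"
      unfolding G_def sum_distrib_left
      by (subst sum.swap) (simp add: mult_ac)
    moreover have "Lx k (x, y) = (\<Sum>j\<in>UNIV. N x y j k * Ly j (x, y))"
      using hor[OF that] by (simp add: Lx_def Ly_def N_def)
    ultimately show ?thesis
      by (simp add: L2 L3 L5 that sum.distrib distrib_left)
  qed
  have G: "(\<Sum>k\<in>UNIV. matrix_inv (fundamental_tensor F x y) $ j $ k *
     ((\<Sum>l\<in>UNIV. y $ l * pd l (\<lambda>x. pd k (\<lambda>y. (F x y)\<^sup>2) y) x) - pd k (\<lambda>x. (F x y)\<^sup>2) x)) = 2 * G y j"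
    if "(x, y) \<in> C" for y j
  proof -
    let ?g = "fundamental_tensor F x y"
    have "(\<Sum>k\<in>UNIV. matrix_inv ?g $ j $ k * (\<Sum>i\<in>UNIV. ?g $ k $ i * (2 * G y i)))
       = (\<Sum>i\<in>UNIV. (\<Sum>k\<in>UNIV. matrix_inv ?g $ j $ k * ?g $ k $ i) * (2 * G y i))"
      unfolding sum_distrib_left sum_distrib_right by (subst sum.swap) (simp add: mult_ac)
    also have "\<dots> = 2 * G y j"
      by (simp add: sum_matrix_inv_left[OF inv[OF that]] if_distrib[of "\<lambda>t. t * _"] cong: if_cong)
    finally show ?thesis by (simp add: spray[OF that])
  qed
  have "nonlinear_conn F x y k i = (1/4) * pd i (\<lambda>y. 2 * G y k) y"
    unfolding nonlinear_conn_def
    by (rule arg_cong[where f="\<lambda>t. (1/4) * t"], rule pd_cong[OF sl(1)[of x]]) (use xy G in auto)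
  also have "\<dots> = (1/2) * pd i (\<lambda>y. G y k) y"
    by (subst pd_cmult) (auto simp: G_def intro!: differentiable_sum differentiable_mult dN)
  also have "pd i (\<lambda>y. G y k) y = N x y k i + (\<Sum>l\<in>UNIV. y $ l * \<Gamma> x k l i)"
    unfolding G_def
    by (simp add: pd_sum pd_mult dN pdN pd_vec_nth sum.distrib if_distrib[of "\<lambda>t. t * _"] cong: if_cong)
  \<comment> \<open>By symmetry of the lower indices both halves of the derivative of the quadratic
    spray agree; this 2 absorbs the remaining factor 1/2.\<close>
  also have "\<dots> = 2 * N x y k i"
    by (simp add: N_def sym[OF xy, of k i] mult.commute)
  finally show ?thesis by (simp add: N_def)
qed

section \<open>Kropina metrics in a chart\<close>

text \<open>Squaring removes the sign that an integer power of a negative base may carry, so both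
  branches of \<open>rpow\<close> become one formula, differentiable for all nonzero
  \<open>t\<close>.\<close>

lemma rpow_power2:
  assumes "rpow_defined t r"
  shows "(rpow t r)\<^sup>2 = exp (r * ln (t\<^sup>2))"
proof -
  have t: "t \<noteq> 0" using assms by (auto simp: rpow_defined_def)
  have ln: "ln (t\<^sup>2) = 2 * ln \<bar>t\<bar>" using t ln_realpow[of "\<bar>t\<bar>" 2] by simp
  show ?thesis
  proof (cases "r \<in> \<int>")
    case True
    then obtain n where r: "r = of_int n" by (auto elim: Ints_cases)
    have "(t powi n)\<^sup>2 = \<bar>t\<bar> powi n * \<bar>t\<bar> powi n"
      by (metis abs_mult_self_eq power2_eq_square power_int_abs)
    also have "\<bar>t\<bar> powi n = exp (of_int n * ln \<bar>t\<bar>)"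
      using t powr_real_of_int'[of "\<bar>t\<bar>" n] by (simp add: powr_def)
    finally show ?thesis by (simp add: rpow_def r ln exp_add[symmetric] algebra_simps)
  next
    case False
    then have "t > 0" using assms by (auto simp: rpow_defined_def)
    then show ?thesis using False ln
      by (simp add: rpow_def powr_def power2_eq_square exp_add[symmetric] algebra_simps)
  qed
qed

text \<open>The hypothesis on \<open>a\<close> reads \<open>\<nabla>_i a = r_i a\<close> for the
  connection \<open>G\<close>. The argument of \<open>D\<close> is the horizontal lift of the i-th
  coordinate field, along which \<open>y\<close> is infinitesimally parallel, so the form changes
  only through \<open>r i\<close>.\<close>

lemma quadratic_form_horizontal_derivative:
  fixes a :: "real^'n \<Rightarrow> real^'n^'n"
  assumes d: "\<And>j l. (\<lambda>x. a x $ j $ l) differentiable (at x)"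
    and a: "\<And>i j l. pd i (\<lambda>x. a x $ j $ l) x
      = (\<Sum>k\<in>UNIV. G k i j * a x $ k $ l) + (\<Sum>k\<in>UNIV. G k i l * a x $ j $ k) + r i * a x $ j $ l"
  obtains D where "((\<lambda>p. snd p \<bullet> (a (fst p) *v snd p)) has_derivative D) (at (x, y))"
    "\<And>i. D (axis i 1, - (\<chi> j. \<Sum>q\<in>UNIV. G j i q * y $ q)) = r i * (y \<bullet> (a x *v y))"
proof
  define D where "D h = (\<Sum>j\<in>UNIV. \<Sum>l\<in>UNIV. a x $ j $ l * (y $ j * snd h $ l + snd h $ j * y $ l)
    + frechet_derivative (\<lambda>x. a x $ j $ l) (at x) (fst h) * (y $ j * y $ l))" for h :: "(real^'n) \<times> (real^'n)"
  have da: "((\<lambda>p. a (fst p) $ j $ l) has_derivative (\<lambda>h. frechet_derivative (\<lambda>x. a x $ j $ l) (at x) (fst h))) (at (x, y))" for j l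
    using has_derivative_compose[OF bounded_linear_imp_has_derivative[OF bounded_linear_fst], of "\<lambda>x. a x $ j $ l" _ "(x, y)"]
      d[unfolded frechet_derivative_works] by simp
  have dy: "((\<lambda>p. snd p $ j) has_derivative (\<lambda>h. snd h $ j)) (at (x, y))" for j
    by (auto intro!: derivative_intros bounded_linear.has_derivative[OF bounded_linear_vec_nth])
  have "((\<lambda>p. \<Sum>j\<in>UNIV. \<Sum>l\<in>UNIV. a (fst p) $ j $ l * (snd p $ j * snd p $ l)) has_derivative
     (\<lambda>h. \<Sum>j\<in>UNIV. \<Sum>l\<in>UNIV. a (fst (x, y)) $ j $ l * (snd (x, y) $ j * snd h $ l + snd h $ j * snd (x, y) $ l)
        + frechet_derivative (\<lambda>x. a x $ j $ l) (at x) (fst h) * (snd (x, y) $ j * snd (x, y) $ l))) (at (x, y))"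
    by (intro has_derivative_sum has_derivative_mult da dy)
  moreover have q: "z \<bullet> (A *v z) = (\<Sum>j\<in>UNIV. \<Sum>l\<in>UNIV. A $ j $ l * (z $ j * z $ l))" for A :: "real^'n^'n" and z
    by (simp add: inner_vec_def matrix_vector_mult_def sum_distrib_left mult_ac)
  ultimately show "((\<lambda>p. snd p \<bullet> (a (fst p) *v snd p)) has_derivative D) (at (x, y))"
    unfolding D_def[abs_def] q by simp
  fix i
  \<comment> \<open>The vertical part of the lift acts on the two slots of the form, here and in
    \<open>2\<close>; after exchanging sums each contribution cancels the connection term of the
    respective slot.\<close>
  have 1: "(\<Sum>j\<in>UNIV. \<Sum>l\<in>UNIV. a x $ j $ l * (y $ j * (\<Sum>q\<in>UNIV. G l i q * y $ q)))
      = (\<Sum>j\<in>UNIV. \<Sum>q\<in>UNIV. (\<Sum>k\<in>UNIV. G k i q * a x $ j $ k) * (y $ j * y $ q))"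
    unfolding sum_distrib_left sum_distrib_right
    by (rule sum.cong[OF refl], subst sum.swap) (simp add: mult_ac)
  have "(\<Sum>j\<in>UNIV. \<Sum>l\<in>UNIV. a x $ j $ l * ((\<Sum>q\<in>UNIV. G j i q * y $ q) * y $ l))
      = (\<Sum>l\<in>UNIV. \<Sum>j\<in>UNIV. a x $ j $ l * ((\<Sum>q\<in>UNIV. G j i q * y $ q) * y $ l))"
    by (rule sum.swap)
  also have "\<dots> = (\<Sum>l\<in>UNIV. \<Sum>q\<in>UNIV. (\<Sum>k\<in>UNIV. G k i q * a x $ k $ l) * (y $ q * y $ l))"
    unfolding sum_distrib_left sum_distrib_right
    by (rule sum.cong[OF refl], subst sum.swap) (simp add: mult_ac)
  also have "\<dots> = (\<Sum>q\<in>UNIV. \<Sum>l\<in>UNIV. (\<Sum>k\<in>UNIV. G k i q * a x $ k $ l) * (y $ q * y $ l))"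
    by (rule sum.swap)
  finally have 2: "(\<Sum>j\<in>UNIV. \<Sum>l\<in>UNIV. a x $ j $ l * ((\<Sum>q\<in>UNIV. G j i q * y $ q) * y $ l))
      = (\<Sum>q\<in>UNIV. \<Sum>l\<in>UNIV. (\<Sum>k\<in>UNIV. G k i q * a x $ k $ l) * (y $ q * y $ l))" .
  show "D (axis i 1, - (\<chi> j. \<Sum>q\<in>UNIV. G j i q * y $ q)) = r i * (y \<bullet> (a x *v y))"
    unfolding D_def q
    using 1 2
    by (simp add: pd_def[symmetric] a distrib_left distrib_right right_diff_distrib sum.distrib
        sum_subtractf sum_negf sum_distrib_left[symmetric] mult.assoc)
qed

text \<open>The same cancellation with a single slot.\<close>

lemma linear_form_horizontal_derivative:
  fixes b :: "real^'n \<Rightarrow> real^'n"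
  assumes d: "\<And>j. (\<lambda>x. b x $ j) differentiable (at x)"
    and b: "\<And>i j. pd i (\<lambda>x. b x $ j) x = (\<Sum>k\<in>UNIV. G k i j * b x $ k) + r i * b x $ j"
  obtains D where "((\<lambda>p. b (fst p) \<bullet> snd p) has_derivative D) (at (x, y))"
    "\<And>i. D (axis i 1, - (\<chi> j. \<Sum>q\<in>UNIV. G j i q * y $ q)) = r i * (b x \<bullet> y)"
proof
  define D where "D h = (\<Sum>j\<in>UNIV. b x $ j * snd h $ j
    + frechet_derivative (\<lambda>x. b x $ j) (at x) (fst h) * y $ j)" for h :: "(real^'n) \<times> (real^'n)"
  have db: "((\<lambda>p. b (fst p) $ j) has_derivative (\<lambda>h. frechet_derivative (\<lambda>x. b x $ j) (at x) (fst h))) (at (x, y))" for j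
    using has_derivative_compose[OF bounded_linear_imp_has_derivative[OF bounded_linear_fst], of "\<lambda>x. b x $ j" _ "(x, y)"]
      d[unfolded frechet_derivative_works] by simp
  have dy: "((\<lambda>p. snd p $ j) has_derivative (\<lambda>h. snd h $ j)) (at (x, y))" for j
    by (auto intro!: derivative_intros bounded_linear.has_derivative[OF bounded_linear_vec_nth])
  have "((\<lambda>p. \<Sum>j\<in>UNIV. b (fst p) $ j * snd p $ j) has_derivative
     (\<lambda>h. \<Sum>j\<in>UNIV. b (fst (x, y)) $ j * snd h $ j
        + frechet_derivative (\<lambda>x. b x $ j) (at x) (fst h) * snd (x, y) $ j)) (at (x, y))"
    by (intro has_derivative_sum has_derivative_mult db dy)
  then show "((\<lambda>p. b (fst p) \<bullet> snd p) has_derivative D) (at (x, y))"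
    unfolding D_def[abs_def] by (simp add: inner_vec_def)
  fix i
  have "(\<Sum>j\<in>UNIV. b x $ j * (\<Sum>q\<in>UNIV. G j i q * y $ q)) = (\<Sum>q\<in>UNIV. (\<Sum>k\<in>UNIV. G k i q * b x $ k) * y $ q)"
    unfolding sum_distrib_left sum_distrib_right by (subst sum.swap) (simp add: mult_ac)
  then show "D (axis i 1, - (\<chi> j. \<Sum>q\<in>UNIV. G j i q * y $ q)) = r i * (b x \<bullet> y)"
    unfolding D_def
    by (simp add: pd_def[symmetric] b inner_vec_def distrib_right sum.distrib sum_negf sum_subtractf sum_distrib_left mult.assoc)
qed

text \<open>Contractions of \<open>a\<close> with its inverse are already evaluated to Kronecker
  deltas, so only \<open>f\<close> has its index raised. This is a Weyl connection: for
  \<open>f = d\<psi>\<close> it is the conformal change of the Levi-Civita connection under the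
  factor \<open>exp (- 2 * m * \<psi>)\<close>.\<close>

definition kropina_christoffel ::
    "real \<Rightarrow> (real^'n \<Rightarrow> real^'n^'n) \<Rightarrow> (real^'n \<Rightarrow> real^'n) \<Rightarrow> ('n::finite) christoffel" where
  "kropina_christoffel m a f x k i j = levi_civita a x k i j
     + m * ((matrix_inv (a x) *v f x) $ k * a x $ i $ j
        - (if k = j then f x $ i else 0) - (if k = i then f x $ j else 0))"

lemma sum_delta_mult [simp]:
  fixes g h :: "'i::finite \<Rightarrow> real"
  shows "(\<Sum>k\<in>UNIV. (if k = j then g k else 0) * h k) = g j * h j"
    and "(\<Sum>k\<in>UNIV. h k * (if k = j then g k else 0)) = g j * h j"
  by (simp_all add: if_distrib[of "\<lambda>t. t * _"] if_distrib[of "\<lambda>t. _ * t"] mult.commute cong: if_cong)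

lemma matrix_inv_mult_vec:
  fixes A :: "real^'n^'n"
  assumes "invertible A"
  shows "(\<Sum>k\<in>UNIV. A $ i $ k * (matrix_inv A *v v) $ k) = v $ i"
proof -
  have "(A *v (matrix_inv A *v v)) $ i = v $ i"
    using assms by (simp add: matrix_vector_mul_assoc matrix_inv_right)
  then show ?thesis by (simp add: matrix_vector_mult_def[of A])
qed

lemma kropina_christoffel_symmetric:
  assumes "open S" "x \<in> S" "\<And>y. y \<in> S \<Longrightarrow> transpose (a y) = a y"
  shows "kropina_christoffel m a f x k i j = kropina_christoffel m a f x k j i"
proof -
  have "a x $ i $ j = a x $ j $ i"
    using assms(2,3) by (auto simp: transpose_def vec_eq_iff)
  then show ?thesis
    using levi_civita_symmetric[OF assms] by (simp add: kropina_christoffel_def)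
qed

text \<open>These are the Christoffel symbols of the first kind: lowering the upper index removes
  the inverse matrix, and later identities become linear in the derivatives of
  \<open>a\<close>.\<close>

lemma lower_levi_civita:
  fixes a :: "real^'n \<Rightarrow> real^'n^'n"
  assumes "invertible (a x)"
  shows "(\<Sum>k\<in>UNIV. a x $ l $ k * levi_civita a x k i j)
    = (1/2) * (pd i (\<lambda>x. a x $ l $ j) x + pd j (\<lambda>x. a x $ l $ i) x - pd l (\<lambda>x. a x $ i $ j) x)"
proof -
  define Z where "Z p = pd i (\<lambda>x. a x $ p $ j) x + pd j (\<lambda>x. a x $ p $ i) x - pd p (\<lambda>x. a x $ i $ j) x" for p
  have "(\<Sum>k\<in>UNIV. a x $ l $ k * levi_civita a x k i j)
     = (1/2) * (\<Sum>k\<in>UNIV. a x $ l $ k * (matrix_inv (a x) *v (\<chi> p. Z p)) $ k)"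
    unfolding levi_civita_def Z_def[symmetric]
    by (simp add: matrix_vector_mult_def sum_distrib_left mult_ac)
  then show ?thesis by (simp add: matrix_inv_mult_vec[OF assms] Z_def)
qed

lemma lower_kropina_christoffel:
  fixes a :: "real^'n \<Rightarrow> real^'n^'n"
  assumes "invertible (a x)"
  shows "(\<Sum>k\<in>UNIV. a x $ l $ k * kropina_christoffel m a f x k i j)
    = (1/2) * (pd i (\<lambda>x. a x $ l $ j) x + pd j (\<lambda>x. a x $ l $ i) x - pd l (\<lambda>x. a x $ i $ j) x)
      + m * (f x $ l * a x $ i $ j - a x $ l $ j * f x $ i - a x $ l $ i * f x $ j)"
proof -
  have "(\<Sum>k\<in>UNIV. a x $ l $ k * kropina_christoffel m a f x k i j)
    = (\<Sum>k\<in>UNIV. a x $ l $ k * levi_civita a x k i j)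
      + m * ((\<Sum>k\<in>UNIV. a x $ l $ k * (matrix_inv (a x) *v f x) $ k) * a x $ i $ j
         - (\<Sum>k\<in>UNIV. a x $ l $ k * (if k = j then f x $ i else 0))
         - (\<Sum>k\<in>UNIV. a x $ l $ k * (if k = i then f x $ j else 0)))"
    unfolding kropina_christoffel_def
    by (simp add: distrib_left right_diff_distrib sum.distrib sum_subtractf sum_distrib_left sum_distrib_right mult_ac
        del: sum_delta_mult)
  then show ?thesis
    by (simp only: lower_levi_civita[of a x, OF assms] matrix_inv_mult_vec[OF assms] sum_delta_mult
        mult.commute[of "f x $ i"] mult.commute[of "f x $ j"])
qed

text \<open>Adding the lowered symbols of the two slots leaves the derivative of \<open>a\<close>
  from the Levi-Civita part, while the terms with \<open>f\<close> collapse to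
  \<open>- 2 * m * f x $ i * a x $ j $ l\<close>.\<close>

lemma kropina_christoffel_metric:
  fixes a :: "real^'n \<Rightarrow> real^'n^'n"
  assumes "open S" "x \<in> S" "\<And>y. y \<in> S \<Longrightarrow> transpose (a y) = a y \<and> invertible (a y)"
  shows "pd i (\<lambda>x. a x $ j $ l) x
    = (\<Sum>k\<in>UNIV. kropina_christoffel m a f x k i j * a x $ k $ l)
      + (\<Sum>k\<in>UNIV. kropina_christoffel m a f x k i l * a x $ j $ k) + 2 * m * f x $ i * a x $ j $ l"
proof -
  have s: "a x $ j $ l = a x $ l $ j" for j l
    using assms(2,3) by (auto simp: transpose_def vec_eq_iff)
  have ds: "pd i (\<lambda>x. a x $ j $ l) x = pd i (\<lambda>x. a x $ l $ j) x" for i j l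
    using assms by (intro pd_cong) (auto simp: transpose_def vec_eq_iff)
  have inv: "invertible (a x)" using assms by blast
  have "(\<Sum>k\<in>UNIV. kropina_christoffel m a f x k i j * a x $ k $ l)
      = (\<Sum>k\<in>UNIV. a x $ l $ k * kropina_christoffel m a f x k i j)"
    by (simp add: s[of l] mult.commute)
  moreover have "(\<Sum>k\<in>UNIV. kropina_christoffel m a f x k i l * a x $ j $ k)
      = (\<Sum>k\<in>UNIV. a x $ j $ k * kropina_christoffel m a f x k i l)"
    by (simp add: mult.commute)
  ultimately show ?thesis
    unfolding lower_kropina_christoffel[of a x, OF inv]
    using s[of i j] s[of i l] s[of j l] ds[of i j l] ds[of j i l] ds[of l i j]
    by (simp add: algebra_simps)
qed

text \<open>The Berwald condition enters here: its terms with \<open>a_ij\<close> and with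
  \<open>f_j b_i\<close> cancel those of the connection, and \<open>f_i b_j\<close> collects the
  coefficients 1 and \<open>m\<close>.\<close>

lemma kropina_christoffel_form:
  fixes a :: "real^'n \<Rightarrow> real^'n^'n"
  assumes "transpose (a x) = a x" "invertible (a x)"
    and b: "\<And>i j. cov_deriv (levi_civita a) b x j i =
          m * (f x \<bullet> (matrix_inv (a x) *v b x)) * a x $ i $ j + b x $ i * f x $ j - m * f x $ i * b x $ j"
  shows "pd i (\<lambda>x. b x $ j) x
    = (\<Sum>k\<in>UNIV. kropina_christoffel m a f x k i j * b x $ k) + (1 + m) * f x $ i * b x $ j"
proof -
  have "a x $ j $ i = a x $ i $ j"
    using assms(1) by (auto simp: transpose_def vec_eq_iff)
  \<comment> \<open>The condition raises the index of \<open>b\<close>, the connection that of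
    \<open>f\<close>; both give the same contraction because the inverse metric is
    symmetric.\<close>
  moreover have "f x \<bullet> (matrix_inv (a x) *v b x) = (\<Sum>k\<in>UNIV. (matrix_inv (a x) *v f x) $ k * b x $ k)"
    unfolding inner_vec_def matrix_vector_mult_def
    by (simp add: sum_distrib_left sum_distrib_right, subst sum.swap)
       (simp add: matrix_inv_symmetric[OF assms(2,1)] mult_ac)
  moreover have "(\<Sum>k\<in>UNIV. kropina_christoffel m a f x k i j * b x $ k)
    = (\<Sum>k\<in>UNIV. levi_civita a x k i j * b x $ k)
      + m * ((\<Sum>k\<in>UNIV. (matrix_inv (a x) *v f x) $ k * b x $ k) * a x $ i $ j
         - (\<Sum>k\<in>UNIV. (if k = j then f x $ i else 0) * b x $ k)
         - (\<Sum>k\<in>UNIV. (if k = i then f x $ j else 0) * b x $ k))"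
    unfolding kropina_christoffel_def
    by (simp add: distrib_left distrib_right right_diff_distrib left_diff_distrib sum.distrib sum_subtractf
        sum_distrib_left sum_distrib_right mult_ac del: sum_delta_mult)
  ultimately show ?thesis
    using b[of i j] by (simp add: cov_deriv_def algebra_simps)
qed

text \<open>The raised \<open>f\<close> and one of the deltas contribute \<open>f x $ k\<close> with
  opposite signs; the other delta has trace \<open>CARD('n)\<close>.\<close>

lemma kropina_christoffel_trace:
  fixes a :: "real^'n \<Rightarrow> real^'n^'n"
  assumes "transpose (a x) = a x" "invertible (a x)"
  shows "(\<Sum>i\<in>UNIV. kropina_christoffel m a f x i i k)
    = (\<Sum>i\<in>UNIV. levi_civita a x i i k) - m * real CARD('n) * f x $ k"
proof -
  have "a x $ i $ k = a x $ k $ i" for i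
    using assms(1) by (auto simp: transpose_def vec_eq_iff)
  then have "(\<Sum>i\<in>UNIV. (matrix_inv (a x) *v f x) $ i * a x $ i $ k) = f x $ k"
    using matrix_inv_mult_vec[OF assms(2), of k "f x"] by (simp add: mult.commute)
  moreover have "(\<Sum>i\<in>UNIV. kropina_christoffel m a f x i i k) = (\<Sum>i\<in>UNIV. levi_civita a x i i k)
     + m * ((\<Sum>i\<in>UNIV. (matrix_inv (a x) *v f x) $ i * a x $ i $ k)
        - (\<Sum>i\<in>UNIV. if i = k then f x $ i else 0) - (\<Sum>i\<in>(UNIV :: 'n set). f x $ k))"
    unfolding kropina_christoffel_def
    by (simp add: sum.distrib sum_subtractf sum_distrib_left right_diff_distrib)
  ultimately show ?thesis by (simp add: algebra_simps)
qed

lemma kropina_ricci_symmetric_iff: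
  fixes a :: "real^'n \<Rightarrow> real^'n^'n"
  assumes "open S" "x \<in> S" "smooth_on S a" "smooth_on S f" "m \<noteq> 0"
    and a: "\<And>y. y \<in> S \<Longrightarrow> transpose (a y) = a y \<and> invertible (a y)"
  shows "ricci (kropina_christoffel m a f) x l k = ricci (kropina_christoffel m a f) x k l
    \<longleftrightarrow> pd l (\<lambda>x. f x $ k) x = pd k (\<lambda>x. f x $ l) x"
proof -
  have sa: "smooth_on S (\<lambda>x. a x $ i $ j)" and sf: "smooth_on S (\<lambda>x. f x $ i)" for i j
    using assms by (auto intro: smooth_on_vec_nth)
  note d = smooth_on_differentiable[OF sa assms(2)] smooth_on_differentiable[OF sf assms(2)]
  have inv: "\<And>y. y \<in> S \<Longrightarrow> invertible (a y)" using a by auto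
  note dlc = levi_civita_differentiable[OF assms(1-3) inv]
  have dif: "(\<lambda>x. if c then f x $ i else 0) differentiable (at x)" for c i
    using d by (cases c) auto
  have dk: "(\<lambda>x. kropina_christoffel m a f x k i j) differentiable (at x)" for k i j
    unfolding kropina_christoffel_def matrix_vector_mult_def vec_lambda_beta
    by (intro differentiable_add differentiable_diff differentiable_mult differentiable_const
        differentiable_sum ballI d dif dlc differentiable_matrix_inv[OF assms(1,2) inv]) simp_all
  have tr: "pd l (\<lambda>y. \<Sum>i\<in>UNIV. kropina_christoffel m a f y i i k) x
     = pd l (\<lambda>y. \<Sum>i\<in>UNIV. levi_civita a y i i k) x - m * real CARD('n) * pd l (\<lambda>x. f x $ k) x" for l k
  proof -
    have "pd l (\<lambda>y. \<Sum>i\<in>UNIV. kropina_christoffel m a f y i i k) x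
      = pd l (\<lambda>y. (\<Sum>i\<in>UNIV. levi_civita a y i i k) - m * real CARD('n) * f y $ k) x"
      using a by (intro pd_cong[OF assms(1,2)] kropina_christoffel_trace) auto
    also have "\<dots> = pd l (\<lambda>y. \<Sum>i\<in>UNIV. levi_civita a y i i k) x - pd l (\<lambda>y. m * real CARD('n) * f y $ k) x"
      using d dlc by (intro pd_diff differentiable_sum differentiable_mult differentiable_const) auto
    finally show ?thesis using pd_cmult[OF d(2)] by simp
  qed
  have "ricci (kropina_christoffel m a f) x l k - ricci (kropina_christoffel m a f) x k l
      = m * real CARD('n) * (pd k (\<lambda>x. f x $ l) x - pd l (\<lambda>x. f x $ k) x)"
    using ricci_antisymmetric_part[OF assms(1,2) kropina_christoffel_symmetric[OF assms(1)] dk, where l=l and k=k] a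
      levi_civita_trace_closed[OF assms(1-3) a, of l k]
    by (simp add: tr right_diff_distrib)
  moreover have "m * real CARD('n) \<noteq> 0" using assms(5) by simp
  ultimately show ?thesis by (auto simp: algebra_simps)
qed

text \<open>Koszul's argument at a single point: only the value and the first derivatives of
  \<open>h\<close> at \<open>x\<close> occur, so \<open>G\<close> is an array of numbers rather than
  a field.\<close>

lemma levi_civita_unique:
  fixes h :: "real^'n \<Rightarrow> real^'n^'n"
  assumes "transpose (h x) = h x" "invertible (h x)"
    and sym: "\<And>k i j. G k i j = G k j i"
    and h: "\<And>i j l. pd i (\<lambda>x. h x $ j $ l) x
      = (\<Sum>k\<in>UNIV. G k i j * h x $ k $ l) + (\<Sum>k\<in>UNIV. G k i l * h x $ j $ k)"
  shows "levi_civita h x = G"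
proof (intro ext)
  fix k i j
  have s: "h x $ j $ l = h x $ l $ j" for j l
    using assms(1) by (auto simp: transpose_def vec_eq_iff)
  \<comment> \<open>Of the six terms produced by \<open>h\<close>, four cancel in pairs by the
    symmetry of \<open>G\<close> and the remaining two coincide.\<close>
  have "pd i (\<lambda>x. h x $ l $ j) x + pd j (\<lambda>x. h x $ l $ i) x - pd l (\<lambda>x. h x $ i $ j) x
     = 2 * (\<Sum>p\<in>UNIV. h x $ l $ p * G p i j)" for l
    unfolding h by (simp add: s[of i] sym[of _ l] sym[of _ j i] mult.commute)
  then have "levi_civita h x k i j = (\<Sum>l\<in>UNIV. matrix_inv (h x) $ k $ l * (\<Sum>p\<in>UNIV. h x $ l $ p * G p i j))"
    unfolding levi_civita_def by (simp add: sum_distrib_left)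
  also have "\<dots> = (\<Sum>p\<in>UNIV. (\<Sum>l\<in>UNIV. matrix_inv (h x) $ k $ l * h x $ l $ p) * G p i j)"
    unfolding sum_distrib_left sum_distrib_right by (subst sum.swap) (simp add: mult_ac)
  also have "\<dots> = G k i j"
    by (simp add: sum_matrix_inv_left[OF assms(2)] if_distrib[of "\<lambda>t. t * _"] cong: if_cong)
  finally show "levi_civita h x k i j = G k i j" .
qed

lemma pd_exp_mult:
  assumes "u differentiable (at x)" "g differentiable (at x)"
  shows "pd i (\<lambda>x. exp (c * u x) * g x) x = exp (c * u x) * (pd i g x + c * pd i u x * g x)"
proof -
  have "((\<lambda>x. exp (c * u x) * g x) has_derivative
     (\<lambda>h. exp (c * u x) * frechet_derivative g (at x) h
        + (c * frechet_derivative u (at x) h * exp (c * u x)) * g x)) (at x)"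
    using assms unfolding frechet_derivative_works
    by (intro has_derivative_mult has_derivative_exp has_derivative_mult_right)
  from pd_eqI[OF this, of i] show ?thesis by (simp add: pd_def algebra_simps)
qed

text \<open>Differentiating the conformal factor removes the recurrence term of
  \<open>kropina_christoffel_metric\<close>. The rescaled metric is then parallel for a symmetric
  connection, which \<open>levi_civita_unique\<close> identifies.\<close>

lemma levi_civita_rescaled:
  fixes a :: "real^'n \<Rightarrow> real^'n^'n"
  assumes "open S" "x \<in> S" "smooth_on S a"
    and a: "\<And>y. y \<in> S \<Longrightarrow> transpose (a y) = a y \<and> invertible (a y)"
    and u: "u differentiable (at x)" "\<And>i. f x $ i = pd i u x"
  shows "levi_civita (\<lambda>x. exp (- 2 * m * u x) *\<^sub>R a x) x = kropina_christoffel m a f x"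
proof (rule levi_civita_unique)
  show "transpose (exp (- 2 * m * u x) *\<^sub>R a x) = exp (- 2 * m * u x) *\<^sub>R a x"
    using a assms(2) by (simp add: transpose_scalar)
  show "invertible (exp (- 2 * m * u x) *\<^sub>R a x)"
    using a assms(2) by (simp add: scalar_invertible)
  show "kropina_christoffel m a f x k i j = kropina_christoffel m a f x k j i" for k i j
    using kropina_christoffel_symmetric[OF assms(1,2)] a by blast
  have d: "(\<lambda>x. a x $ j $ l) differentiable (at x)" for j l
    using smooth_on_differentiable[OF smooth_on_vec_nth[OF assms(1) smooth_on_vec_nth[OF assms(1,3)]] assms(2)] .
  show "pd i (\<lambda>x. (exp (- 2 * m * u x) *\<^sub>R a x) $ j $ l) x
      = (\<Sum>k\<in>UNIV. kropina_christoffel m a f x k i j * (exp (- 2 * m * u x) *\<^sub>R a x) $ k $ l)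
      + (\<Sum>k\<in>UNIV. kropina_christoffel m a f x k i l * (exp (- 2 * m * u x) *\<^sub>R a x) $ j $ k)" for i j l
    using pd_exp_mult[OF u(1) d[of j l], of i "-2 * m"] kropina_christoffel_metric[OF assms(1,2) a, where i=i and j=j and l=l and m=m and f=f]
    by (simp add: u(2) sum_distrib_left mult_ac distrib_left)
qed

lemma cov_deriv_rescaled:
  fixes b :: "real^'n \<Rightarrow> real^'n"
  assumes "(\<lambda>x. b x $ i) differentiable (at x)" "u differentiable (at x)"
    and b: "pd j (\<lambda>x. b x $ i) x = (\<Sum>k\<in>UNIV. G x k j i * b x $ k) + c * pd j u x * b x $ i"
  shows "cov_deriv G (\<lambda>x. exp (- c * u x) *\<^sub>R b x) x j i = 0"
  using pd_exp_mult[OF assms(2,1), of j "- c"] b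
  by (simp add: cov_deriv_def sum_distrib_left mult_ac distrib_left)

lemma has_derivative_ln_power2:
  fixes u :: "'a::real_normed_vector \<Rightarrow> real"
  assumes "(u has_derivative D) (at z)" "u z \<noteq> 0"
  shows "((\<lambda>p. ln ((u p)\<^sup>2)) has_derivative (\<lambda>h. D h * (2 / u z))) (at z)"
proof -
  have "((\<lambda>t. ln (t\<^sup>2)) has_real_derivative 2 / u z) (at (u z))"
    using assms(2) by (auto intro!: derivative_eq_intros simp: zero_less_power2 power2_eq_square[of "u z"] divide_inverse zero_less_mult_iff)
  from DERIV_compose_FDERIV[OF this assms(1)] show ?thesis .
qed

lemma kropina_nonlinear_conn:
  fixes a :: "real^'n \<Rightarrow> real^'n^'n" and F :: "real^'n \<Rightarrow> real^'n \<Rightarrow> real"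
  assumes "open S" "smooth_on S a" "smooth_on S b"
    and a: "\<And>x. x \<in> S \<Longrightarrow> transpose (a x) = a x \<and> invertible (a x)"
    and b: "\<And>x i j. x \<in> S \<Longrightarrow> cov_deriv (levi_civita a) b x j i =
          m * (f x \<bullet> (matrix_inv (a x) *v b x)) * a x $ i $ j + b x $ i * f x $ j - m * f x $ i * b x $ j"
    and C: "open C" "\<And>x y. (x, y) \<in> C \<Longrightarrow> x \<in> S"
    and F: "smooth_on C (\<lambda>(x, y). F x y)"
      "\<And>x y. (x, y) \<in> C \<Longrightarrow> invertible (fundamental_tensor F x y)"
      "\<And>x y. (x, y) \<in> C \<Longrightarrow> rpow_defined (sqrt \<bar>y \<bullet> (a x *v y)\<bar>) (1 + m) \<and> rpow_defined (b x \<bullet> y) (- m) \<and>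
         F x y = rpow (sqrt \<bar>y \<bullet> (a x *v y)\<bar>) (1 + m) * rpow (b x \<bullet> y) (- m)"
    and xy: "(x, y) \<in> C"
  shows "nonlinear_conn F x y k i = (\<Sum>j\<in>UNIV. kropina_christoffel m a f x k i j * y $ j)"
proof -
  define L where "L = (\<lambda>p. (F (fst p) (snd p))\<^sup>2)"
  define A where "A = (\<lambda>p. snd p \<bullet> (a (fst p) *v snd p))"
  define B where "B = (\<lambda>p. b (fst p) \<bullet> snd p)"
  have "smooth_on C (\<lambda>p. F (fst p) (snd p) * F (fst p) (snd p))"
    using F(1) C(1) by (intro smooth_on_mult) (simp_all add: case_prod_unfold)
  then have sL: "smooth_on C L" by (simp add: L_def power2_eq_square)
  have nz: "A p \<noteq> 0" "B p \<noteq> 0" and L: "L p = exp ((1 + m) / 2 * ln ((A p)\<^sup>2) + - m * ln ((B p)\<^sup>2))" if "p \<in> C" for p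
  proof -
    have p: "(fst p, snd p) \<in> C" using that by simp
    show nA: "A p \<noteq> 0" and nB: "B p \<noteq> 0"
      using F(3)[OF p] by (auto simp: A_def B_def rpow_defined_def)
    \<comment> \<open>\<open>F^2\<close> contains the power \<open>1 + m\<close> of
      \<open>\<bar>A p\<bar>\<close>; passing to the square of \<open>A p\<close> allows either sign
      and costs the factor 1/2.\<close>
    have "ln \<bar>A p\<bar> = (1/2) * ln ((A p)\<^sup>2)"
      using nA ln_realpow[of "\<bar>A p\<bar>" 2] by simp
    then have "(rpow (sqrt \<bar>A p\<bar>) (1 + m))\<^sup>2 = exp ((1 + m) / 2 * ln ((A p)\<^sup>2))"
      using F(3)[OF p] by (subst rpow_power2) (simp_all add: A_def)
    moreover have "(rpow (B p) (- m))\<^sup>2 = exp (- m * ln ((B p)\<^sup>2))"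
      using F(3)[OF p] by (subst rpow_power2) (simp_all add: B_def)
    ultimately show "L p = exp ((1 + m) / 2 * ln ((A p)\<^sup>2) + - m * ln ((B p)\<^sup>2))"
      using F(3)[OF p] by (simp only: L_def A_def B_def power_mult_distrib exp_add)
  qed
  have hor: "frechet_derivative L (at (x, y)) (axis i 1, 0)
      = (\<Sum>j\<in>UNIV. (\<Sum>q\<in>UNIV. kropina_christoffel m a f x j i q * y $ q) * frechet_derivative L (at (x, y)) (0, axis j 1))"
    if xy: "(x, y) \<in> C" for x y i
  proof -
    define w where "w = (\<chi> j. \<Sum>q\<in>UNIV. kropina_christoffel m a f x j i q * y $ q)"
    have x: "x \<in> S" using C(2) xy .
    have da: "(\<lambda>x. a x $ j $ l) differentiable (at x)" and db: "(\<lambda>x. b x $ j) differentiable (at x)" for j l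
      using assms(1-3) by (auto intro!: smooth_on_differentiable[OF _ x] smooth_on_vec_nth)
    have ca: "pd i (\<lambda>x. a x $ j $ l) x = (\<Sum>k\<in>UNIV. kropina_christoffel m a f x k i j * a x $ k $ l)
        + (\<Sum>k\<in>UNIV. kropina_christoffel m a f x k i l * a x $ j $ k) + 2 * m * f x $ i * a x $ j $ l" for i j l
      using assms(1) x a by (rule kropina_christoffel_metric)
    obtain DA where DA: "(A has_derivative DA) (at (x, y))" "\<And>i. DA (axis i 1, - (\<chi> j. \<Sum>q\<in>UNIV. kropina_christoffel m a f x j i q * y $ q)) = 2 * m * f x $ i * (y \<bullet> (a x *v y))"
      unfolding A_def by (rule quadratic_form_horizontal_derivative[OF da ca, where y=y]) (rule that[unfolded A_def])
    have cb: "pd i (\<lambda>x. b x $ j) x = (\<Sum>k\<in>UNIV. kropina_christoffel m a f x k i j * b x $ k) + (1 + m) * f x $ i * b x $ j" for i j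
      by (rule kropina_christoffel_form) (use a[OF x] b[OF x] in auto)
    obtain DB where DB: "(B has_derivative DB) (at (x, y))" "\<And>i. DB (axis i 1, - (\<chi> j. \<Sum>q\<in>UNIV. kropina_christoffel m a f x j i q * y $ q)) = (1 + m) * f x $ i * (b x \<bullet> y)"
      unfolding B_def by (rule linear_form_horizontal_derivative[OF db cb, where y=y]) (rule that[unfolded B_def])
    have DAw: "DA (axis i 1, - w) = 2 * m * f x $ i * A (x, y)" and DBw: "DB (axis i 1, - w) = (1 + m) * f x $ i * B (x, y)"
      unfolding w_def DA(2) DB(2) by (simp_all add: A_def B_def)
    define E where "E = (\<lambda>p. exp ((1 + m) / 2 * ln ((A p)\<^sup>2) + - m * ln ((B p)\<^sup>2)))"
    define DE where "DE h = ((1 + m) / 2 * (DA h * (2 / A (x, y))) + - m * (DB h * (2 / B (x, y)))) * E (x, y)" for h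
    have "(E has_derivative DE) (at (x, y))"
      unfolding E_def DE_def[abs_def]
      by (intro has_derivative_exp has_derivative_add has_derivative_mult_right has_derivative_ln_power2 DA(1) DB(1) nz[OF xy])
    then have DL: "(L has_derivative DE) (at (x, y))"
      by (rule has_derivative_transform_within_open[OF _ C(1) xy]) (simp add: L E_def)
    then have fr: "frechet_derivative L (at (x, y)) = DE" by (simp add: frechet_derivative_at[symmetric])
    have lin: "linear DE" using DL has_derivative_linear by blast
    have "DE (axis i 1, - w) = 0"
      unfolding DE_def DAw DBw using nz[OF xy] by (simp add: field_simps)
    \<comment> \<open>A coordinate direction is its horizontal lift plus a vertical vector. As
      \<open>DE\<close> vanishes on the lift, only fibre derivatives remain, which is horizontality
      in the required form.\<close>
    moreover have "(axis i 1, 0) = (axis i 1, - w) + (\<Sum>j\<in>UNIV. w $ j *\<^sub>R (0 :: real^'n, axis j 1))"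
    proof -
      have "(\<Sum>j\<in>UNIV. w $ j *\<^sub>R (0 :: real^'n, axis j 1)) = (0, \<Sum>j\<in>UNIV. w $ j *\<^sub>R axis j 1)"
        by (simp add: prod_eq_iff fst_sum snd_sum)
      also have "(\<Sum>j\<in>UNIV. w $ j *\<^sub>R axis j 1) = w"
        using basis_expansion[of w] by (simp add: scalar_mult_eq_scaleR)
      finally show ?thesis by simp
    qed
    ultimately have "DE (axis i 1, 0) = (\<Sum>j\<in>UNIV. w $ j * DE (0, axis j 1))"
      using lin by (simp add: linear_add linear_sum linear_cmul del: scaleR_Pair)
    then show ?thesis by (simp add: fr w_def)
  qed
  show ?thesis
  proof (rule nonlinear_conn_if_horizontal[OF C(1) _ _ _ F(2) xy])
    show "Ck_on 2 C (\<lambda>p. (F (fst p) (snd p))\<^sup>2)" using sL by (simp add: smooth_on_def L_def)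
    show "kropina_christoffel m a f x k i j = kropina_christoffel m a f x k j i" if "(x, y) \<in> C" for x y k i j
      using kropina_christoffel_symmetric[OF assms(1) C(2)[OF that]] a by blast
  qed (use hor in \<open>simp add: L_def\<close>)
qed

section \<open>Charts\<close>

lemma is_chart_inj_on: "is_chart X c \<Longrightarrow> inj_on (snd c) (fst c)"
  using homeomorphic_imp_injective_map[of "subtopology X (fst c)" _ "snd c"] openin_subset[of X "fst c"]
  unfolding is_chart_def by (auto simp: topspace_subtopology Int_absorb1)

lemma open_coords:
  assumes "is_chart X c" "openin X W"
  shows "open (coords c W)"
proof -
  have "openin (subtopology X (fst c)) (fst c \<inter> W)"
    using assms(2) by (simp add: openin_subtopology_Int2)
  then have "openin (top_of_set (snd c ` fst c)) (snd c ` (fst c \<inter> W))"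
    using assms(1) homeomorphic_imp_open_map unfolding is_chart_def open_map_def by blast
  then show ?thesis
    using assms(1) openin_open_eq unfolding is_chart_def coords_def by blast
qed

text \<open>A function on the manifold therefore has the same value when read in either chart, which
  makes rescaling by it compatible with the transformation laws.\<close>

lemma chart_inv_transition:
  assumes "inj_on (snd c) (fst c)" "inj_on (snd d) (fst d)" "x \<in> coords c (fst d \<inter> W)"
  shows "chart_inv d (transition c d x) = chart_inv c x"
proof -
  obtain p where "x = snd c p" "p \<in> fst c" "p \<in> fst d"
    using assms(3) by (auto simp: coords_def)
  then show ?thesis using assms(1,2) by (simp add: transition_def chart_inv_def)
qed

text \<open>A linear map is determined by its values on a nonempty open set, since differences of
  vectors in it reach every basis direction. This discharges the definite description.\<close>

lemma affine_connection_eqI: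
  fixes G :: "'n::finite \<Rightarrow> 'n \<Rightarrow> 'n \<Rightarrow> real"
  assumes "open (C c)" "(x, y0) \<in> C c"
    and G: "\<And>y k i. (x, y) \<in> C c \<Longrightarrow> nonlinear_conn (F c) x y k i = (\<Sum>j\<in>UNIV. G k i j * y $ j)"
  shows "affine_connection C F c x = G"
  unfolding affine_connection_def
proof (rule the_equality)
  fix H :: "'n \<Rightarrow> 'n \<Rightarrow> 'n \<Rightarrow> real"
  assume H: "\<forall>y. (x, y) \<in> C c \<longrightarrow> (\<forall>k i. nonlinear_conn (F c) x y k i = (\<Sum>j\<in>UNIV. H k i j * y $ j))"
  have "open {y. (x, y) \<in> C c}" using open_Pair_slices assms(1) by blast
  then obtain e where e: "e > 0" "ball y0 e \<subseteq> {y. (x, y) \<in> C c}"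
    using assms(2) openE by blast
  show "H = G"
  proof (intro ext)
    fix k i l
    \<comment> \<open>Half the radius keeps \<open>z\<close> in the fibre; subtracting the equation
      at \<open>y0\<close> isolates the coefficient with index \<open>l\<close>.\<close>
    define z where "z = y0 + (e / 2) *\<^sub>R axis l 1"
    have "z \<in> ball y0 e" using e(1) by (simp add: z_def dist_norm)
    then have "(x, z) \<in> C c" using e(2) by auto
    then have "(\<Sum>j\<in>UNIV. H k i j * z $ j) = (\<Sum>j\<in>UNIV. G k i j * z $ j)"
      "(\<Sum>j\<in>UNIV. H k i j * y0 $ j) = (\<Sum>j\<in>UNIV. G k i j * y0 $ j)"
      using G H assms(2) by metis+
    moreover have "(\<Sum>j\<in>UNIV. T j * z $ j) = (\<Sum>j\<in>UNIV. T j * y0 $ j) + e / 2 * T l" for T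
      by (simp add: z_def axis_def distrib_left sum.distrib if_distrib[of "\<lambda>t. _ * t"] cong: if_cong)
    ultimately show "H k i l = G k i l" using e(1) by simp
  qed
qed (use G in blast)

section \<open>Metrizability\<close>

lemma ricci_cong:
  assumes "open S" "x \<in> S" "\<And>y. y \<in> S \<Longrightarrow> \<Gamma> y = \<Gamma>' y"
  shows "ricci \<Gamma> x l k = ricci \<Gamma>' x l k"
proof -
  have "pd i (\<lambda>x. \<Gamma> x k' j l) x = pd i (\<lambda>x. \<Gamma>' x k' j l) x" for i k' j l
    using assms by (intro pd_cong) auto
  then show ?thesis using assms(2,3) by (simp add: ricci_def curvature_def)
qed

lemma smooth_manifoldD:
  assumes "smooth_manifold X \<A>" "c \<in> \<A>"
  shows "inj_on (snd c) (fst c)" "openin X W \<Longrightarrow> open (coords c W)"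
proof -
  have "is_chart X c" using assms by (simp add: smooth_manifold_def)
  then show "inj_on (snd c) (fst c)" "openin X W \<Longrightarrow> open (coords c W)"
    by (rule is_chart_inj_on, rule open_coords)
qed

lemma kropina_affine_connection:
  assumes "smooth_manifold X \<A>" "kropina_metric X \<A> C m a b F" "kropina_berwald_condition X \<A> m a b f"
    and "c \<in> \<A>" "x \<in> coords c (topspace X)"
  shows "affine_connection C F c x = kropina_christoffel m (a c) (f c) x"
proof -
  have C: "open (C c)" "fst ` C c = coords c (topspace X)"
    using assms(2,4) by (auto simp: kropina_metric_def finsler_metric_def conic_subbundle_def)
  have a: "smooth_on (coords c (topspace X)) (a c)"
    "\<And>x. x \<in> coords c (topspace X) \<Longrightarrow> transpose (a c x) = a c x \<and> invertible (a c x)"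
    and b: "smooth_on (coords c (topspace X)) (b c)"
    using assms(2,4) by (auto simp: kropina_metric_def pseudo_riemannian_def one_form_def)
  have F: "smooth_on (C c) (\<lambda>(x, y). F c x y)"
    "\<And>x y. (x, y) \<in> C c \<Longrightarrow> invertible (fundamental_tensor (F c) x y)"
    using assms(2,4) unfolding kropina_metric_def finsler_metric_def by blast+
  have K: "\<And>x y. (x, y) \<in> C c \<Longrightarrow> rpow_defined (sqrt \<bar>y \<bullet> (a c x *v y)\<bar>) (1 + m) \<and> rpow_defined (b c x \<bullet> y) (- m) \<and>
         F c x y = rpow (sqrt \<bar>y \<bullet> (a c x *v y)\<bar>) (1 + m) * rpow (b c x \<bullet> y) (- m)"
    using assms(2,4) unfolding kropina_metric_def Let_def by blast
  have cond: "\<And>x i j. x \<in> coords c (topspace X) \<Longrightarrow> cov_deriv (levi_civita (a c)) (b c) x j i =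
          m * (f c x \<bullet> (matrix_inv (a c x) *v b c x)) * a c x $ i $ j
          + b c x $ i * f c x $ j - m * f c x $ i * b c x $ j"
    using assms(3,4) unfolding kropina_berwald_condition_def by blast
  have sub: "\<And>x y. (x, y) \<in> C c \<Longrightarrow> x \<in> coords c (topspace X)"
    using C(2) by force
  have o: "open (coords c (topspace X))" using smooth_manifoldD(2)[OF assms(1,4) openin_topspace] .
  \<comment> \<open>The subbundle projects onto the whole coordinate domain, so the fibre over
    \<open>x\<close> contains a vector, as uniqueness of the coefficients requires.\<close>
  obtain y0 where "(x, y0) \<in> C c" using C(2) assms(5) by force
  then show ?thesis
    using kropina_nonlinear_conn[OF o a(1) b a(2) cond C(1) sub F K]
    by (intro affine_connection_eqI[of C, OF C(1)])
qed

lemma ricci_symmetric_iff_closed: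
  assumes "smooth_manifold X \<A>" "kropina_metric X \<A> C m a b F" "kropina_berwald_condition X \<A> m a b f"
    and "one_form \<A> (topspace X) f" "m \<noteq> 0"
  shows "ricci_symmetric X \<A> C F \<longleftrightarrow> closed_form \<A> (topspace X) f"
proof -
  have "ricci (affine_connection C F c) x l k = ricci (affine_connection C F c) x k l
      \<longleftrightarrow> pd l (\<lambda>x. f c x $ k) x = pd k (\<lambda>x. f c x $ l) x"
    if c: "c \<in> \<A>" and x: "x \<in> coords c (topspace X)" for c x l k
  proof -
    have o: "open (coords c (topspace X))" using smooth_manifoldD(2)[OF assms(1) c openin_topspace] .
    have r: "ricci (affine_connection C F c) x l k = ricci (kropina_christoffel m (a c) (f c)) x l k" for l k
      using kropina_affine_connection[OF assms(1-3) c] by (intro ricci_cong[OF o x])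
    show ?thesis
      unfolding r using assms(2,4,5) c
      by (intro kropina_ricci_symmetric_iff[OF o x])
         (auto simp: kropina_metric_def pseudo_riemannian_def one_form_def)
  qed
  then show ?thesis unfolding ricci_symmetric_def closed_form_def by blast
qed

lemma metrizable_imp_locally_metrizable: "metrizable X \<A> C F \<Longrightarrow> locally_metrizable X \<A> C F"
  unfolding metrizable_def locally_metrizable_def by blast

text \<open>The Ricci tensor at a point depends only on the connection nearby, and there it is a
  Levi-Civita connection.\<close>

lemma locally_metrizable_imp_ricci_symmetric:
  assumes "smooth_manifold X \<A>" "locally_metrizable X \<A> C F"
  shows "ricci_symmetric X \<A> C F"
  unfolding ricci_symmetric_def
proof (intro ballI allI)
  fix c x l k
  assume c: "c \<in> \<A>" and "x \<in> coords c (topspace X)"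
  then obtain p where p: "p \<in> fst c" "p \<in> topspace X" "x = snd c p" by (auto simp: coords_def)
  then obtain W h where W: "openin X W" "p \<in> W" "metrization_on \<A> C F W h"
    using assms(2) unfolding locally_metrizable_def by blast
  have o: "open (coords c W)" using smooth_manifoldD(2)[OF assms(1) c W(1)] .
  have x: "x \<in> coords c W" using p W(2) by (auto simp: coords_def)
  have h: "smooth_on (coords c W) (h c)"
    "\<And>y. y \<in> coords c W \<Longrightarrow> transpose (h c y) = h c y \<and> invertible (h c y)"
    "\<And>y. y \<in> coords c W \<Longrightarrow> affine_connection C F c y = levi_civita (h c) y"
    using W(3) c by (auto simp: metrization_on_def pseudo_riemannian_def)
  have "ricci (affine_connection C F c) x l k = ricci (levi_civita (h c)) x l k" for l k
    using h(3) by (rule ricci_cong[OF o x])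
  then show "ricci (affine_connection C F c) x l k = ricci (affine_connection C F c) x k l"
    using ricci_levi_civita_symmetric[OF o x h(1,2)] by simp
qed

text \<open>The factor is a function on the manifold, equal in both charts, so it passes through the
  Jacobians; being positive, it preserves invertibility.\<close>

lemma pseudo_riemannian_rescaled:
  assumes "smooth_manifold X \<A>" "openin X W" "pseudo_riemannian \<A> W a" "smooth_fun \<A> W \<psi>"
  shows "pseudo_riemannian \<A> W (\<lambda>c x. exp (r * \<psi> (chart_inv c x)) *\<^sub>R a c x)"
  unfolding pseudo_riemannian_def
proof (intro conjI ballI)
  fix c assume c: "c \<in> \<A>"
  show "smooth_on (coords c W) (\<lambda>x. exp (r * \<psi> (chart_inv c x)) *\<^sub>R a c x)"
    using smooth_on_exp_scaleR[OF smooth_manifoldD(2)[OF assms(1) c assms(2)], of "\<psi> \<circ> chart_inv c" "a c" r]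
      assms(3,4) c by (simp add: pseudo_riemannian_def smooth_fun_def)
next
  fix c d x assume c: "c \<in> \<A>" "d \<in> \<A>" "x \<in> coords c (fst d \<inter> W)"
  have "chart_inv d (transition c d x) = chart_inv c x"
    using chart_inv_transition[OF _ _ c(3)] smooth_manifoldD(1)[OF assms(1)] c by blast
  moreover have "a c x = transpose (trans_jac c d x) ** a d (transition c d x) ** trans_jac c d x"
    using assms(3) c unfolding pseudo_riemannian_def by blast
  ultimately show "exp (r * \<psi> (chart_inv c x)) *\<^sub>R a c x = transpose (trans_jac c d x)
      ** (exp (r * \<psi> (chart_inv d (transition c d x))) *\<^sub>R a d (transition c d x)) ** trans_jac c d x"
    by (simp add: matrix_scalar_ac scalar_matrix_assoc[symmetric])
next
  fix c x assume "c \<in> \<A>" "x \<in> coords c W"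
  then have "transpose (a c x) = a c x" "invertible (a c x)"
    using assms(3) unfolding pseudo_riemannian_def by blast+
  then show "transpose (exp (r * \<psi> (chart_inv c x)) *\<^sub>R a c x) = exp (r * \<psi> (chart_inv c x)) *\<^sub>R a c x"
    "invertible (exp (r * \<psi> (chart_inv c x)) *\<^sub>R a c x)"
    by (simp_all add: transpose_scalar scalar_invertible)
qed

lemma kropina_metrization:
  assumes "smooth_manifold X \<A>" "kropina_metric X \<A> C m a b F" "kropina_berwald_condition X \<A> m a b f"
    and \<psi>: "smooth_fun \<A> (topspace X) \<psi>" "is_differential \<A> (topspace X) \<psi> f"
  defines "a' \<equiv> \<lambda>c x. exp (- 2 * m * \<psi> (chart_inv c x)) *\<^sub>R a c x"
    and "b' \<equiv> \<lambda>c x. exp (- (1 + m) * \<psi> (chart_inv c x)) *\<^sub>R b c x"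
  shows "metrization_on \<A> C F (topspace X) a' \<and> parallel_form \<A> (topspace X) a' b'"
proof -
  have a: "pseudo_riemannian \<A> (topspace X) a" and b: "one_form \<A> (topspace X) b"
    using assms(2) by (auto simp: kropina_metric_def)
  have lc: "levi_civita (a' c) x = kropina_christoffel m (a c) (f c) x"
    and par: "cov_deriv (levi_civita (a' c)) (b' c) x j i = 0"
    if c: "c \<in> \<A>" and x: "x \<in> coords c (topspace X)" for c x i j
  proof -
    let ?S = "coords c (topspace X)"
    have o: "open ?S" using smooth_manifoldD(2)[OF assms(1) c openin_topspace] .
    have ac: "smooth_on ?S (a c)" "\<And>y. y \<in> ?S \<Longrightarrow> transpose (a c y) = a c y \<and> invertible (a c y)"
      using a c by (auto simp: pseudo_riemannian_def)
    have u: "(\<psi> \<circ> chart_inv c) differentiable (at x)" "\<And>i. f c x $ i = pd i (\<psi> \<circ> chart_inv c) x"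
      using \<psi> c x by (auto simp: smooth_fun_def is_differential_def intro: smooth_on_differentiable)
    show lc: "levi_civita (a' c) x = kropina_christoffel m (a c) (f c) x"
      using levi_civita_rescaled[where f="f c", OF o x ac u] by (simp add: a'_def)
    have db: "(\<lambda>x. b c x $ i) differentiable (at x)"
      using b c x o by (auto simp: one_form_def intro!: smooth_on_differentiable smooth_on_vec_nth)
    have "pd j (\<lambda>x. b c x $ i) x
       = (\<Sum>k\<in>UNIV. kropina_christoffel m (a c) (f c) x k j i * b c x $ k) + (1 + m) * f c x $ j * b c x $ i"
      using ac(2)[OF x] assms(3) c x
      by (intro kropina_christoffel_form) (auto simp: kropina_berwald_condition_def)
    \<comment> \<open>By \<open>lc\<close> the recurrence of \<open>b\<close> under the Kropina
      connection is one under the Levi-Civita connection of \<open>a'\<close>, with coefficient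
      \<open>1 + m\<close>.\<close>
    then show "cov_deriv (levi_civita (a' c)) (b' c) x j i = 0"
      using cov_deriv_rescaled[OF db u(1), of j "levi_civita (a' c)" "1 + m"]
      by (simp add: b'_def lc u(2))
  qed
  have "pseudo_riemannian \<A> (topspace X) a'"
    unfolding a'_def by (rule pseudo_riemannian_rescaled[OF assms(1) openin_topspace a \<psi>(1)])
  then show ?thesis
    using lc par kropina_affine_connection[OF assms(1-3)]
    by (simp add: metrization_on_def parallel_form_def)
qed

theorem theorem16:
  fixes X :: "'p topology"
    and \<A> :: "('p, 'n::finite) chart set"
    and C :: "('p, 'n) tangent_subset"
    and F :: "('p, 'n) tangent_fun"
    and a :: "('p, 'n) tensor2_field"
    and b f :: "('p, 'n) covector_field"
    and m :: real
  assumes "smooth_manifold X \<A>"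
    and "CARD('n) > 2"
    and "m \<noteq> 0"
    and "kropina_metric X \<A> C m a b F"
    and "berwald_type \<A> C F"
    and "one_form \<A> (topspace X) f"
    and "kropina_berwald_condition X \<A> m a b f"
    and "trivial_H1_dR \<A> (topspace X)"
  shows "(metrizable X \<A> C F \<longleftrightarrow> locally_metrizable X \<A> C F)
    \<and> (locally_metrizable X \<A> C F \<longleftrightarrow> ricci_symmetric X \<A> C F)
    \<and> (ricci_symmetric X \<A> C F \<longleftrightarrow> closed_form \<A> (topspace X) f)
    \<and> (closed_form \<A> (topspace X) f \<longrightarrow>
         (\<exists>\<psi>. smooth_fun \<A> (topspace X) \<psi> \<and> is_differential \<A> (topspace X) \<psi> f) \<and>
         (\<forall>\<psi>. smooth_fun \<A> (topspace X) \<psi> \<and> is_differential \<A> (topspace X) \<psi> f \<longrightarrow>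
            (let a' = (\<lambda>c x. exp (- 2 * m * \<psi> (chart_inv c x)) *\<^sub>R a c x);
                 b' = (\<lambda>c x. exp (- (1 + m) * \<psi> (chart_inv c x)) *\<^sub>R b c x)
             in metrization_on \<A> C F (topspace X) a' \<and> parallel_form \<A> (topspace X) a' b')))"
proof -
  have 1: "ricci_symmetric X \<A> C F \<longleftrightarrow> closed_form \<A> (topspace X) f"
    using ricci_symmetric_iff_closed[OF assms(1,4,7,6,3)] .
  \<comment> \<open>Trivial cohomology enters here: it supplies the potential that makes the
    conformal factor a global function.\<close>
  have 2: "\<exists>\<psi>. smooth_fun \<A> (topspace X) \<psi> \<and> is_differential \<A> (topspace X) \<psi> f"
    if "closed_form \<A> (topspace X) f"
    using assms(6,8) that unfolding trivial_H1_dR_def exact_form_def by blast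
  note 3 = kropina_metrization[OF assms(1,4,7)]
  have 4: "metrizable X \<A> C F" if "closed_form \<A> (topspace X) f"
    using 2[OF that] 3 unfolding metrizable_def by blast
  have 5: "locally_metrizable X \<A> C F \<Longrightarrow> ricci_symmetric X \<A> C F"
    using locally_metrizable_imp_ricci_symmetric[OF assms(1)] .
  \<comment> \<open>The cycle: a closed \<open>f\<close> gives a global metrization, hence local
    ones, hence a symmetric Ricci tensor, hence closedness again.\<close>
  show ?thesis
    unfolding Let_def using 1 2 3 4 5 metrizable_imp_locally_metrizable[of X \<A> C F] by blast
qed

end
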